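(* Let $d\ge1$, let $t_n\to\infty$ be a sequence of reals, and for $1\le i\le d$ let $\mathcal{T}_i$ be a flow on $(X_i,\mathcal{B}_i,\mu_i)$ which is $\alpha_i$-weakly mixing along $(t_n)$ for some $\alpha_i\in(0,1)$. Let $\mathcal{S}_i$ be a weakly mixing flow on $(Y_i,\mathcal{C}_i,\nu_i)$ for $1\le i\le d$. If $\mathcal{T}_1\times\dots\times\mathcal{T}_d$ is isomorphic to $\mathcal{S}_1\times\dots\times\mathcal{S}_d$, then there exists a permutation $\sigma$ of $\{1,\dots,d\}$ such that $\mathcal{T}_i$ is isomorphic to $\mathcal{S}_{\sigma(i)}$ for all $i$. More precisely, if $\Phi\colon Y_1\times\dots\times Y_d\to X_1\times\dots\times X_d$ is an isomorphism between $\mathcal{S}_1\times\dots\times\mathcal{S}_d$ and $\mathcal{T}_1\times\dots\times\mathcal{T}_d$, then there is a permutation $\sigma$ such that for each $i$ the restriction of $f\mapsto f\circ\Phi$ to $L^2(\mathcal{B}_i)$ yields an isomorphism between $\mathcal{T}_i$ and $\mathcal{S}_{\sigma(i)}$, i.e. it maps $L^2(\mathcal{B}_i)$ onto $L^2(\mathcal{C}_{\sigma(i)})$.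
   Context: A flow $\mathcal{T}=(T^t)_{t\in\mathbb{R}}$ is a measure-preserving $\mathbb{R}$-action on a standard Borel probability space $(X,\mathcal{B},\mu)$ such that $t\mapsto\langle f\circ T^t,g\rangle$ is continuous for all $f,g\in L^2(X,\mathcal{B},\mu)$. All flows are assumed nontrivial (the space is not a one-point space up to measure zero). The product flow is $(T_1^t\times\dots\times T_d^t)_{t\in\mathbb{R}}$ on the product probability space. A flow $\mathcal{T}$ is weakly mixing if $\mathcal{T}\times\mathcal{T}$ is ergodic. An isomorphism between flows $\mathcal{S}$ on $Y$ and $\mathcal{T}$ on $X$ is an invertible (mod null sets) measure-preserving map $\Phi\colon Y\to X$ with $T^t\circ\Phi=\Phi\circ S^t$ a.e. for every $t$. Write $T^tf=f\circ T^t$ and $\Pi f=\int f\,d\mu$ for $f\in L^2(X,\mathcal{B},\mu)$. For $\alpha\in(0,1)$, $\mathcal{T}$ is $\alpha$-weakly mixing along $t_n\to\infty$ if $T^{t_n}\to\alpha\cdot\Pi+(1-\alpha)\cdot\mathrm{Id}$ in the weak operator topology on $L^2(X,\mathcal{B},\mu)$. $\mathcal{B}_i$ (resp. $\mathcal{C}_i$) is also regarded as the $i$-th coordinate sub-$\sigma$-algebra of $X_1\times\dots\times X_d$ (resp. $Y_1\times\dots\times Y_d$), and $L^2(\mathcal{B}_i)$ (resp. $L^2(\mathcal{C}_i)$) as the subspace of functions of the product space depending only on the $i$-th coordinate. *)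

theory Defs
  imports "HOL-Probability.Probability" "HOL-Combinatorics.Permutations"
begin

definition standard_borel :: "'a measure \<Rightarrow> bool" where
  "standard_borel M \<longleftrightarrow>
     (\<exists>\<tau>. completely_metrizable_space \<tau> \<and> second_countable \<tau> \<and>
          topspace \<tau> = space M \<and> sets M = sigma_sets (space M) {U. openin \<tau> U})"

text \<open>Elements of \<open>L\<^sup>2\<close> are represented by functions; they are only ever compared almost everywhere.\<close>

definition L2 :: "'a measure \<Rightarrow> ('a \<Rightarrow> complex) set" where
  "L2 M = {f \<in> borel_measurable M. integrable M (\<lambda>x. (norm (f x))\<^sup>2)}"

definition L2_inner :: "'a measure \<Rightarrow> ('a \<Rightarrow> complex) \<Rightarrow> ('a \<Rightarrow> complex) \<Rightarrow> complex" where
  "L2_inner M f g = (\<integral>x. f x * cnj (g x) \<partial>M)"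

definition koopman :: "('a \<Rightarrow> 'b) \<Rightarrow> ('b \<Rightarrow> complex) \<Rightarrow> 'a \<Rightarrow> complex" where
  "koopman \<phi> f = f \<circ> \<phi>"

definition mean_op :: "'a measure \<Rightarrow> ('a \<Rightarrow> complex) \<Rightarrow> 'a \<Rightarrow> complex" where
  "mean_op M f = (\<lambda>_. \<integral>x. f x \<partial>M)"

definition wot_tendsto ::
  "'a measure \<Rightarrow> (nat \<Rightarrow> ('a \<Rightarrow> complex) \<Rightarrow> 'a \<Rightarrow> complex) \<Rightarrow> (('a \<Rightarrow> complex) \<Rightarrow> 'a \<Rightarrow> complex) \<Rightarrow> bool" where
  "wot_tendsto M A B \<longleftrightarrow>
     (\<forall>f\<in>L2 M. \<forall>g\<in>L2 M. (\<lambda>n. L2_inner M (A n f) g) \<longlonglongrightarrow> L2_inner M (B f) g)"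

text \<open>
  The action is only required to be measurable for each fixed time; regularity in time is
  the weak continuity on \<open>L\<^sup>2\<close>. The last axiom is the standing nontriviality assumption.
\<close>

locale flow = prob_space M for M :: "'a measure" +
  fixes T :: "real \<Rightarrow> 'a \<Rightarrow> 'a"
  assumes standard: "standard_borel M"
    and measurable_T: "\<And>t. T t \<in> measurable M M"
    and preserving: "\<And>t. distr M M (T t) = M"
    and action_zero: "\<And>x. x \<in> space M \<Longrightarrow> T 0 x = x"
    and action_add: "\<And>s t x. x \<in> space M \<Longrightarrow> T (s + t) x = T s (T t x)"
    and weakly_continuous: "\<And>f g. f \<in> L2 M \<Longrightarrow> g \<in> L2 M \<Longrightarrow>
          continuous_on UNIV (\<lambda>t. L2_inner M (koopman (T t) f) g)"
    and nontrivial: "\<not> (\<exists>x\<in>space M. AE y in M. y = x)"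

definition pair_flow ::
  "(real \<Rightarrow> 'a \<Rightarrow> 'a) \<Rightarrow> (real \<Rightarrow> 'b \<Rightarrow> 'b) \<Rightarrow> real \<Rightarrow> 'a \<times> 'b \<Rightarrow> 'a \<times> 'b" where
  "pair_flow T S t = map_prod (T t) (S t)"

definition product_flow ::
  "'i set \<Rightarrow> ('i \<Rightarrow> real \<Rightarrow> 'a \<Rightarrow> 'a) \<Rightarrow> real \<Rightarrow> ('i \<Rightarrow> 'a) \<Rightarrow> 'i \<Rightarrow> 'a" where
  "product_flow I T t x = (\<lambda>i\<in>I. T i t (x i))"

text \<open>
  Invariance is taken modulo null sets for each time, that is, as invariance of the indicator
  in \<open>L\<^sup>2\<close>; without joint measurability, strict invariance could give a weaker notion of ergodicity.
\<close>

definition ergodic :: "'a measure \<Rightarrow> (real \<Rightarrow> 'a \<Rightarrow> 'a) \<Rightarrow> bool" where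
  "ergodic M T \<longleftrightarrow>
     (\<forall>A\<in>sets M. (\<forall>t. AE x in M. T t x \<in> A \<longleftrightarrow> x \<in> A) \<longrightarrow> measure M A = 0 \<or> measure M A = 1)"

definition weakly_mixing :: "'a measure \<Rightarrow> (real \<Rightarrow> 'a \<Rightarrow> 'a) \<Rightarrow> bool" where
  "weakly_mixing M T \<longleftrightarrow> ergodic (M \<Otimes>\<^sub>M M) (pair_flow T T)"

definition alpha_weakly_mixing_along ::
  "'a measure \<Rightarrow> (real \<Rightarrow> 'a \<Rightarrow> 'a) \<Rightarrow> real \<Rightarrow> (nat \<Rightarrow> real) \<Rightarrow> bool" where
  "alpha_weakly_mixing_along M T \<alpha> t \<longleftrightarrow>
     wot_tendsto M (\<lambda>n. koopman (T (t n)))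
       (\<lambda>f x. of_real \<alpha> * mean_op M f x + of_real (1 - \<alpha>) * f x)"

definition flow_isomorphism ::
  "'b measure \<Rightarrow> (real \<Rightarrow> 'b \<Rightarrow> 'b) \<Rightarrow> 'a measure \<Rightarrow> (real \<Rightarrow> 'a \<Rightarrow> 'a) \<Rightarrow> ('b \<Rightarrow> 'a) \<Rightarrow> bool" where
  "flow_isomorphism N S M T \<Phi> \<longleftrightarrow>
     \<Phi> \<in> measurable N M \<and> distr N M \<Phi> = M \<and>
     (\<exists>\<Psi>\<in>measurable M N. (AE y in N. \<Psi> (\<Phi> y) = y) \<and> (AE x in M. \<Phi> (\<Psi> x) = x)) \<and>
     (\<forall>t. AE y in N. T t (\<Phi> y) = \<Phi> (S t y))"

definition isomorphic_flows ::
  "'a measure \<Rightarrow> (real \<Rightarrow> 'a \<Rightarrow> 'a) \<Rightarrow> 'b measure \<Rightarrow> (real \<Rightarrow> 'b \<Rightarrow> 'b) \<Rightarrow> bool" where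
  "isomorphic_flows M T N S \<longleftrightarrow> (\<exists>\<Phi>. flow_isomorphism N S M T \<Phi>)"

definition L2_coord :: "'i set \<Rightarrow> ('i \<Rightarrow> 'a measure) \<Rightarrow> 'i \<Rightarrow> (('i \<Rightarrow> 'a) \<Rightarrow> complex) set" where
  "L2_coord I M i = {f \<in> L2 (PiM I M). \<exists>h\<in>L2 (M i). AE x in PiM I M. f x = h (x i)}"

text \<open>\<open>A\<close> maps \<open>V\<close> onto \<open>W\<close>, where functions on \<open>N\<close> are identified if they agree almost everywhere.\<close>

definition maps_onto_ae ::
  "'b measure \<Rightarrow> (('a \<Rightarrow> complex) \<Rightarrow> 'b \<Rightarrow> complex) \<Rightarrow> ('a \<Rightarrow> complex) set \<Rightarrow> ('b \<Rightarrow> complex) set \<Rightarrow> bool" where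
  "maps_onto_ae N A V W \<longleftrightarrow>
     (\<forall>f\<in>V. A f \<in> W) \<and> (\<forall>g\<in>W. \<exists>f\<in>V. AE y in N. A f y = g y)"

text \<open>
  The operator \<open>f \<mapsto> f \<circ> \<Phi>\<close>, restricted to functions of the \<open>i\<close>-th coordinate, is onto the
  functions of the \<open>j\<close>-th coordinate and is there composition with an isomorphism \<open>\<phi>\<close> of
  the factor flows.
\<close>

definition restricts_to_isomorphism ::
  "'i set \<Rightarrow> ('i \<Rightarrow> 'b measure) \<Rightarrow> ('i \<Rightarrow> real \<Rightarrow> 'b \<Rightarrow> 'b) \<Rightarrow>
   ('i \<Rightarrow> 'a measure) \<Rightarrow> ('i \<Rightarrow> real \<Rightarrow> 'a \<Rightarrow> 'a) \<Rightarrow>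
   (('i \<Rightarrow> 'b) \<Rightarrow> 'i \<Rightarrow> 'a) \<Rightarrow> 'i \<Rightarrow> 'i \<Rightarrow> bool" where
  "restricts_to_isomorphism I Y S X T \<Phi> i j \<longleftrightarrow>
     maps_onto_ae (PiM I Y) (koopman \<Phi>) (L2_coord I X i) (L2_coord I Y j) \<and>
     (\<exists>\<phi>. flow_isomorphism (Y j) (S j) (X i) (T i) \<phi> \<and>
        (\<forall>h\<in>L2 (X i). AE y in PiM I Y. koopman \<Phi> (\<lambda>x. h (x i)) y = koopman \<phi> h (y j)))"

end

theory Submission imports Defs begin

text \<open>
  Fix the product \<open>X\<close> of the flows \<open>T i\<close> and the product \<open>Y\<close> of the flows \<open>S j\<close>. For a set \<open>A\<close> of
  coordinates, let the coupling over \<open>A\<close> be the law of a point and of its copy in which the coordinates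
  outside \<open>A\<close> are resampled independently (\<open>coupling\<close>). An event depends only on the coordinates in \<open>A\<close>,
  up to null sets, iff almost surely under this law it contains both points or none (\<open>depends_on\<close>).
  The idea is to show that the isomorphism respects these couplings up to equivalence of measures.

  On \<open>X\<close>, \<open>\<alpha>\<close>-weak mixing says that the joint law of a point and its translate by \<open>t n\<close> converges, on
  products of events, to the joining \<open>\<rho>\<close> in which every coordinate \<open>i\<close> is resampled independently with
  probability \<open>\<alpha> i\<close> (\<open>tendsto_limit_joining\<close>). This \<open>\<rho>\<close> is a mixture, with positive weights, of all the
  couplings. As it dominates a multiple of the product measure, the product flow is ergodic; applied to
  the direct square of the product flow, of which every coupling is a factor, this shows that all
  couplings on \<open>X\<close> are ergodic (\<open>ergodic_coupling\<close>).

  Transport \<open>\<rho>\<close> to \<open>Y\<close>. There it is again a limit of joint laws of a point and its translate, so it is a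
  product over the coordinates \<open>j\<close> (\<open>limit_joining_Y_boxes\<close>). Since the diagonal measure and the product
  measure are absolutely continuous with respect to \<open>\<rho>\<close>, so is every coupling over a set \<open>B\<close> of
  coordinates of \<open>Y\<close>, which is a product of diagonals and product measures
  (\<open>coupling_absolutely_continuous\<close>). Back on \<open>X\<close>, the support of this coupling is an invariant event of
  \<open>\<rho>\<close>. By ergodicity the coupling over \<open>B\<close> is equivalent to a sum of couplings over some sets \<open>A\<close> of
  coordinates of \<open>X\<close> (\<open>coupling_equivalent\<close>). An event depending on each of several sets of coordinates
  depends on their intersection (\<open>depends_on_Int\<close>). Hence there is a set \<open>\<gamma> B\<close> such that the
  \<open>\<Phi>\<close>-preimage of an event depends on \<open>B\<close> iff the event depends on \<open>\<gamma> B\<close> (\<open>depends_on_transport\<close>).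

  The factors being nontrivial, \<open>\<gamma>\<close> is strictly monotone, so it maps singletons to singletons and
  induces a permutation of the coordinates (\<open>coordinates_match\<close>). For matched coordinates \<open>i\<close> and \<open>j\<close>, the
  \<open>i\<close>-th coordinate of \<open>\<Phi> y\<close> is a function of the \<open>j\<close>-th coordinate of \<open>y\<close>, obtained by freezing the other
  coordinates at a generic point, and symmetrically for the inverse of \<open>\<Phi>\<close>. These functions are
  the isomorphisms between the factors (\<open>restricts_to_isomorphism\<close>).
\<close>

section \<open>Convergence of measures on generators\<close>

text \<open>
  Convergence on a generator extends to all events if the measures have a common finite upper bound:
  countable disjoint unions are handled by Tannery's theorem.
\<close>

lemma tendsto_measure_generator:
  assumes M: "finite_measure M" "sets M = sigma_sets (space M) E" "Int_stable E"
      "E \<subseteq> Pow (space M)" "space M \<in> E"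
    and N: "\<And>n. finite_measure (N n)" "\<And>n. sets (N n) = sets M"
    and L: "finite_measure L" "sets L = sets M"
    and dom: "\<And>n A. A \<in> sets M \<Longrightarrow> measure (N n) A \<le> measure M A"
    and conv: "\<And>A. A \<in> E \<Longrightarrow> (\<lambda>n::nat. measure (N n) A) \<longlonglongrightarrow> measure L A"
    and A: "A \<in> sets M"
  shows "(\<lambda>n. measure (N n) A) \<longlonglongrightarrow> measure L A"
proof -
  interpret M: finite_measure M by fact
  interpret N: finite_measure "N n" for n by fact
  interpret L: finite_measure L by fact
  have sp: "space (N n) = space M" "space L = space M" for n
    using N(2) L(2) by (auto dest: sets_eq_imp_space_eq)
  have "A \<in> sigma_sets (space M) E" using A M(2) by simp
  with M(3,4) show ?thesis
  proof (induction rule: sigma_sets_induct_disjoint)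
    case (basic A) then show ?case by (rule conv)
  next
    case empty then show ?case by simp
  next
    case (compl A)
    then have "A \<in> sets M" using M(2) by simp
    then have "measure (N n) (space M - A) = measure (N n) (space M) - measure (N n) A"
      "measure L (space M - A) = measure L (space M) - measure L A" for n
      using N.finite_measure_compl[of A n] L.finite_measure_compl[of A] sp N(2) L(2) by auto
    then show ?case using compl conv[OF M(5)] by (auto intro!: tendsto_diff)
  next
    case (union B)
    have B: "range B \<subseteq> sets M" using union M(2) by simp
    then have Bk: "B k \<in> sets M" for k by auto
    have eq: "measure (N n) (\<Union>i. B i) = (\<Sum>i. measure (N n) (B i))"
      "measure L (\<Union>i. B i) = (\<Sum>i. measure L (B i))" for n
      using N.finite_measure_UNION[of B n] L.finite_measure_UNION[of B] union(1) B N(2) L(2)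
      by (auto simp: sums_iff)
    have sm: "summable (\<lambda>i. measure M (B i))"
      using M.finite_measure_UNION[OF B union(1)] by (simp add: sums_iff)
    have "((\<lambda>n. suminf (\<lambda>k. measure (N n) (B k))) \<longlonglongrightarrow> (\<Sum>k. measure L (B k)))"
      by (rule tannerys_theorem[where M="\<lambda>k. measure M (B k)", THEN conjunct2, THEN conjunct2])
        (use union sm dom[OF Bk] in \<open>auto intro!: always_eventually\<close>)
    then show ?case by (simp add: eq)
  qed
qed

text \<open>The law of \<open>f\<close> under \<open>K\<close>, restricted to the event \<open>B\<close>.\<close>

definition restricted_law :: "'k measure \<Rightarrow> 'k set \<Rightarrow> 'a measure \<Rightarrow> ('k \<Rightarrow> 'a) \<Rightarrow> 'a measure" where
  "restricted_law K B M f = distr (density K (indicator B)) M f"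

lemma restricted_law:
  assumes f: "f \<in> measurable K M" and B: "B \<in> sets K" and K: "finite_measure K"
  shows emeasure_restricted_law:
      "A \<in> sets M \<Longrightarrow> emeasure (restricted_law K B M f) A = emeasure K (f -` A \<inter> B)"
    and measure_restricted_law:
      "A \<in> sets M \<Longrightarrow> measure (restricted_law K B M f) A = measure K (f -` A \<inter> B)"
    and finite_measure_restricted_law: "finite_measure (restricted_law K B M f)"
proof -
  interpret finite_measure K by fact
  have Bs: "B \<subseteq> space K" using B by (rule sets.sets_into_space)
  show ev: "emeasure (restricted_law K B M f) A = emeasure K (f -` A \<inter> B)" if A: "A \<in> sets M" for A
  proof -
    have "f -` A \<inter> space K \<in> sets K" using f A by (rule measurable_sets)
    then have "emeasure (restricted_law K B M f) A = emeasure K (B \<inter> (f -` A \<inter> space K))"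
      using f A B by (simp add: restricted_law_def emeasure_distr emeasure_restricted)
    also have "B \<inter> (f -` A \<inter> space K) = f -` A \<inter> B" using Bs by auto
    finally show ?thesis .
  qed
  then show "A \<in> sets M \<Longrightarrow> measure (restricted_law K B M f) A = measure K (f -` A \<inter> B)" for A
    by (simp add: measure_def)
  show "finite_measure (restricted_law K B M f)"
  proof (rule finite_measureI)
    have "emeasure (restricted_law K B M f) (space M) \<noteq> \<infinity>" by (subst ev) simp_all
    then show "emeasure (restricted_law K B M f) (space (restricted_law K B M f)) \<noteq> \<infinity>"
      by (simp add: restricted_law_def)
  qed
qed

text \<open>
  The form in which convergence on generators is applied: the approximating and the limiting
  measures are restricted to events \<open>C n\<close> and \<open>D\<close> and projected to the fixed space \<open>M\<close>.
\<close>

lemma tendsto_measure_vimage_generator: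
  assumes M: "finite_measure M" "sets M = sigma_sets (space M) E" "Int_stable E"
      "E \<subseteq> Pow (space M)" "space M \<in> E"
    and Q: "\<And>n. finite_measure (Q n)" "\<And>n. h n \<in> measurable (Q n) M" "\<And>n. distr (Q n) M (h n) = M"
      "\<And>n. C n \<in> sets (Q n)"
    and R: "finite_measure R" "k \<in> measurable R M" "D \<in> sets R"
    and conv: "\<And>A. A \<in> E \<Longrightarrow>
       (\<lambda>n::nat. measure (Q n) (h n -` A \<inter> C n)) \<longlonglongrightarrow> measure R (k -` A \<inter> D)"
    and A: "A \<in> sets M"
  shows "(\<lambda>n. measure (Q n) (h n -` A \<inter> C n)) \<longlonglongrightarrow> measure R (k -` A \<inter> D)"
proof -
  note q = restricted_law[OF Q(2) Q(4) Q(1)] and r = restricted_law[OF R(2) R(3) R(1)]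
  have E: "A \<in> sets M" if "A \<in> E" for A using that M(2) by auto
  have dom: "measure (restricted_law (Q n) (C n) M (h n)) A \<le> measure M A" if A: "A \<in> sets M" for n A
  proof -
    interpret finite_measure "Q n" by fact
    have "measure (Q n) (h n -` A \<inter> C n) \<le> measure (Q n) (h n -` A \<inter> space (Q n))"
      using sets.sets_into_space[OF Q(4)] measurable_sets[OF Q(2) A]
      by (intro finite_measure_mono) auto
    also have "\<dots> = measure (distr (Q n) M (h n)) A" using A Q(2) by (simp add: measure_distr)
    finally show ?thesis by (simp add: Q(3) q(2)[OF A])
  qed
  have "(\<lambda>n. measure (restricted_law (Q n) (C n) M (h n)) A) \<longlonglongrightarrow> measure (restricted_law R D M k) A"
    by (rule tendsto_measure_generator[OF M q(3) _ r(3) _ dom _ A])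
      (use conv in \<open>auto simp: q(2)[OF E] r(2)[OF E]\<close>, auto simp: restricted_law_def)
  then show ?thesis by (simp add: q(2)[OF A] r(2)[OF A])
qed

section \<open>Partial resampling of coordinates\<close>

text \<open>Keep the coordinates of \<open>x\<close> in \<open>A\<close> and take the other ones from \<open>z\<close>.\<close>

definition mix :: "'i set \<Rightarrow> 'i set \<Rightarrow> ('i \<Rightarrow> 'a) \<Rightarrow> ('i \<Rightarrow> 'a) \<Rightarrow> 'i \<Rightarrow> 'a" where
  "mix I A x z = (\<lambda>i\<in>I. if i \<in> A then x i else z i)"

text \<open>
  The relatively independent self-joining over the coordinates in \<open>A\<close>: the law of a point and of
  its copy in which the coordinates outside \<open>A\<close> are resampled independently.
\<close>

definition coupling :: "'i set \<Rightarrow> ('i \<Rightarrow> 'a measure) \<Rightarrow> 'i set \<Rightarrow> (('i \<Rightarrow> 'a) \<times> ('i \<Rightarrow> 'a)) measure" where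
  "coupling I M A = distr (PiM I M \<Otimes>\<^sub>M PiM I M) (PiM I M \<Otimes>\<^sub>M PiM I M) (\<lambda>(x, z). (x, mix I A x z))"

lemma measurable_mix [measurable (raw)]:
  assumes [measurable]: "f \<in> measurable N (PiM I M)" "g \<in> measurable N (PiM I M)"
  shows "(\<lambda>w. mix I A (f w) (g w)) \<in> measurable N (PiM I M)"
proof -
  have [measurable]: "(\<lambda>w. f w i) \<in> measurable N (M i)" "(\<lambda>w. g w i) \<in> measurable N (M i)"
    if "i \<in> I" for i
    using that by (auto intro: measurable_compose[OF _ measurable_component_singleton])
  show ?thesis unfolding mix_def
    by (intro measurable_restrict) (auto split: if_splits)
qed

lemma mix_space: "x \<in> space (PiM I M) \<Longrightarrow> z \<in> space (PiM I M) \<Longrightarrow> mix I A x z \<in> space (PiM I M)"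
  by (auto simp: mix_def space_PiM PiE_iff)

lemma mix_mix_left: "mix I A' (mix I A x z) u = mix I (A \<inter> A') x (mix I A' z u)"
  by (auto simp: mix_def fun_eq_iff)

lemma mix_mix_left_mono: "A \<subseteq> A' \<Longrightarrow> mix I A (mix I A' x z) u = mix I A x u"
  by (auto simp: mix_def fun_eq_iff)

lemma mix_self: "x \<in> space (PiM I M) \<Longrightarrow> mix I I x z = x"
  by (auto simp: mix_def fun_eq_iff space_PiM PiE_iff extensional_def)

lemma mix_empty: "z \<in> space (PiM I M) \<Longrightarrow> mix I {} x z = z"
  by (auto simp: mix_def fun_eq_iff space_PiM PiE_iff extensional_def)

lemma mix_in_PiE_iff: "mix I A x z \<in> Pi\<^sub>E I F \<longleftrightarrow> (\<forall>i\<in>I. (if i \<in> A then x i else z i) \<in> F i)"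
  by (auto simp: mix_def PiE_iff)

lemma sets_coupling [measurable_cong, simp]: "sets (coupling I M A) = sets (PiM I M \<Otimes>\<^sub>M PiM I M)"
  and space_coupling [simp]: "space (coupling I M A) = space (PiM I M \<Otimes>\<^sub>M PiM I M)"
  by (simp_all add: coupling_def)

lemma measurable_coupling_map:
  "(\<lambda>(x, z). (x, mix I A x z)) \<in> measurable (PiM I M \<Otimes>\<^sub>M PiM I M) (PiM I M \<Otimes>\<^sub>M PiM I M)"
  by measurable

section \<open>Boxes\<close>

text \<open>Measurable boxes, a generator of the product \<open>\<sigma>\<close>-algebra for finite \<open>I\<close>.\<close>

definition boxes :: "'i set \<Rightarrow> ('i \<Rightarrow> 'a measure) \<Rightarrow> ('i \<Rightarrow> 'a) set set" where
  "boxes I M = {Pi\<^sub>E I G | G. \<forall>i\<in>I. G i \<in> sets (M i)}"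

lemma boxes_generate:
  assumes "finite I"
  shows "sets (PiM I M) = sigma_sets (space (PiM I M)) (boxes I M)"
    and "Int_stable (boxes I M)" and "boxes I M \<subseteq> Pow (space (PiM I M))"
    and "space (PiM I M) \<in> boxes I M" and "boxes I M \<subseteq> sets (PiM I M)"
proof -
  have eq: "boxes I M = prod_algebra I M"
    unfolding prod_algebra_eq_finite[OF assms] boxes_def by (auto simp: Pi_iff)
  show g: "sets (PiM I M) = sigma_sets (space (PiM I M)) (boxes I M)"
    by (simp add: eq sets_PiM space_PiM)
  show "Int_stable (boxes I M)" by (simp add: eq Int_stable_prod_algebra)
  show "boxes I M \<subseteq> Pow (space (PiM I M))"
    using prod_algebra_sets_into_space[of I M] by (simp add: eq space_PiM)
  show "space (PiM I M) \<in> boxes I M" by (auto simp: boxes_def space_PiM)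
  show "boxes I M \<subseteq> sets (PiM I M)" unfolding g by blast
qed

lemma measure_eqI_pair_boxes:
  assumes I: "finite I" "finite J"
    and sets: "sets P = sets (PiM I M \<Otimes>\<^sub>M PiM J N)" "sets Q = sets (PiM I M \<Otimes>\<^sub>M PiM J N)"
    and fin: "finite_measure P"
    and eq: "\<And>G F. (\<And>i. i \<in> I \<Longrightarrow> G i \<in> sets (M i)) \<Longrightarrow> (\<And>i. i \<in> J \<Longrightarrow> F i \<in> sets (N i)) \<Longrightarrow>
       emeasure P (Pi\<^sub>E I G \<times> Pi\<^sub>E J F) = emeasure Q (Pi\<^sub>E I G \<times> Pi\<^sub>E J F)"
  shows "P = Q"
proof -
  let ?S = "space (PiM I M) \<times> space (PiM J N)"
  let ?E = "{a \<times> b | a b. a \<in> boxes I M \<and> b \<in> boxes J N}"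
  note b1 = boxes_generate[OF I(1), of M] and b2 = boxes_generate[OF I(2), of N]
  have "sets (PiM I M \<Otimes>\<^sub>M PiM J N) = sets (sigma ?S ?E)"
    by (rule sets_pair_eq[where Ca="{space (PiM I M)}" and Cb="{space (PiM J N)}"])
      (use b1 b2 in auto)
  also have "\<dots> = sigma_sets ?S ?E"
    using b1(3) b2(3) by (intro sets_measure_of) blast
  finally have g: "sets (PiM I M \<Otimes>\<^sub>M PiM J N) = sigma_sets ?S ?E" .
  show ?thesis
  proof (rule measure_eqI_generator_eq[where E="?E" and \<Omega>="?S" and A="\<lambda>_. ?S"])
    show "Int_stable ?E"
    proof (rule Int_stableI)
      fix c d assume "c \<in> ?E" "d \<in> ?E"
      then obtain a b a' b' where ab: "c = a \<times> b" "d = a' \<times> b'"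
        "a \<in> boxes I M" "b \<in> boxes J N" "a' \<in> boxes I M" "b' \<in> boxes J N" by blast
      then have "c \<inter> d = (a \<inter> a') \<times> (b \<inter> b')" by auto
      moreover have "a \<inter> a' \<in> boxes I M" "b \<inter> b' \<in> boxes J N"
        using ab b1(2) b2(2) by (auto dest: Int_stableD)
      ultimately show "c \<inter> d \<in> ?E" by blast
    qed
    show "?E \<subseteq> Pow ?S" using b1(3) b2(3) by blast
    show "emeasure P c = emeasure Q c" if "c \<in> ?E" for c
      using that eq by (auto simp: boxes_def)
    show "sets P = sigma_sets ?S ?E" "sets Q = sigma_sets ?S ?E" using sets g by auto
    show "range (\<lambda>_. ?S) \<subseteq> ?E" using b1(4) b2(4) by blast
    show "emeasure P ?S \<noteq> \<infinity>" for i :: nat using fin by (simp add: finite_measure.emeasure_finite)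
  qed simp
qed

section \<open>Finite mixtures of measures\<close>

text \<open>
  The combination of the measures \<open>D s\<close> with nonnegative weights \<open>c s\<close>; \<open>N\<close> only provides the
  underlying measurable space.
\<close>

definition mixture :: "'b measure \<Rightarrow> 'c set \<Rightarrow> ('c \<Rightarrow> real) \<Rightarrow> ('c \<Rightarrow> 'b measure) \<Rightarrow> 'b measure" where
  "mixture N S c D = measure_of (space N) (sets N) (\<lambda>E. \<Sum>s\<in>S. ennreal (c s) * emeasure (D s) E)"

lemma sets_mixture [measurable_cong, simp]: "sets (mixture N S c D) = sets N"
  and space_mixture [simp]: "space (mixture N S c D) = space N"
  by (simp_all add: mixture_def)

lemma emeasure_mixture:
  assumes D: "\<And>s. s \<in> S \<Longrightarrow> sets (D s) = sets N" and E: "E \<in> sets N"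
  shows "emeasure (mixture N S c D) E = (\<Sum>s\<in>S. ennreal (c s) * emeasure (D s) E)"
proof (rule emeasure_measure_of[OF mixture_def])
  show "sets N \<subseteq> Pow (space N)" by (rule sets.space_closed)
  show "E \<in> sets (mixture N S c D)" using E by simp
  show "positive (sets (mixture N S c D)) (\<lambda>E. \<Sum>s\<in>S. ennreal (c s) * emeasure (D s) E)"
    by (simp add: positive_def)
  show "countably_additive (sets (mixture N S c D)) (\<lambda>E. \<Sum>s\<in>S. ennreal (c s) * emeasure (D s) E)"
  proof (rule countably_additiveI)
    fix F :: "nat \<Rightarrow> 'b set"
    assume F: "range F \<subseteq> sets (mixture N S c D)" "disjoint_family F"
    have "(\<Sum>i. \<Sum>s\<in>S. ennreal (c s) * emeasure (D s) (F i)) = (\<Sum>s\<in>S. \<Sum>i. ennreal (c s) * emeasure (D s) (F i))"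
      by (rule suminf_sum) (rule summableI)
    also have "\<dots> = (\<Sum>s\<in>S. ennreal (c s) * emeasure (D s) (\<Union>i. F i))"
      using F D by (intro sum.cong refl) (simp add: suminf_emeasure)
    finally show "(\<Sum>i. \<Sum>s\<in>S. ennreal (c s) * emeasure (D s) (F i)) =
        (\<Sum>s\<in>S. ennreal (c s) * emeasure (D s) (\<Union>i. F i))" .
  qed
qed

lemma AE_mixture_iff:
  assumes D: "\<And>s. s \<in> S \<Longrightarrow> sets (D s) = sets N" and S: "finite S" "\<And>s. s \<in> S \<Longrightarrow> 0 < c s"
    and P: "{x \<in> space N. P x} \<in> sets N"
  shows "(AE x in mixture N S c D. P x) \<longleftrightarrow> (\<forall>s\<in>S. AE x in D s. P x)"
proof -
  have sp: "space (D s) = space N" if "s \<in> S" for s using D[OF that] by (rule sets_eq_imp_space_eq)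
  have P': "{x \<in> space N. \<not> P x} \<in> sets N" using P by (rule sets.sets_Collect_neg)
  have "(AE x in mixture N S c D. P x) \<longleftrightarrow> emeasure (mixture N S c D) {x \<in> space N. \<not> P x} = 0"
    by (rule AE_iff_measurable) (simp_all only: sets_mixture space_mixture P')
  also have "\<dots> \<longleftrightarrow> (\<forall>s\<in>S. emeasure (D s) {x \<in> space N. \<not> P x} = 0)"
    using S by (force simp: emeasure_mixture[OF D P'] ennreal_eq_0_iff not_le[symmetric])
  also have "\<dots> \<longleftrightarrow> (\<forall>s\<in>S. AE x in D s. P x)"
  proof (intro ball_cong refl)
    fix s assume "s \<in> S"
    then show "emeasure (D s) {x \<in> space N. \<not> P x} = 0 \<longleftrightarrow> (AE x in D s. P x)"
      by (intro AE_iff_measurable[symmetric]) (simp_all only: sp D P')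
  qed
  finally show ?thesis .
qed

section \<open>Couplings in a finite product\<close>

context finite_product_prob_space
begin

abbreviation P where "P \<equiv> PiM I M"

lemma prob_P: "prob_space P" by unfold_locales

lemma pair_prob: "pair_prob_space P P" by unfold_locales

lemma emeasure_pair_P:
  "A \<in> sets P \<Longrightarrow> B \<in> sets P \<Longrightarrow> emeasure (P \<Otimes>\<^sub>M P) (A \<times> B) = emeasure P A * emeasure P B"
  by (rule sigma_finite_measure.emeasure_pair_measure_Times[OF prob_space_imp_sigma_finite[OF prob_P]])

lemma distr_mix: "distr (P \<Otimes>\<^sub>M P) P (\<lambda>(x, z). mix I A x z) = P"
proof (rule measure_eqI_PiM_finite[OF finite_index, symmetric])
  interpret PP: pair_prob_space P P by (rule pair_prob)
  show "range (\<lambda>_::nat. space P) \<subseteq> prod_algebra I M" "(\<Union>n::nat. space P) = space P"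
    using space_in_prod_algebra[of I M] by (auto simp: space_PiM)
  show "emeasure P (Pi\<^sub>E I G) = emeasure (distr (P \<Otimes>\<^sub>M P) P (\<lambda>(x, z). mix I A x z)) (Pi\<^sub>E I G)"
    if G: "\<And>i. i \<in> I \<Longrightarrow> G i \<in> sets (M i)" for G
  proof -
    let ?G = "\<lambda>i. if i \<in> A then G i else space (M i)" and ?F = "\<lambda>i. if i \<in> A then space (M i) else G i"
    have sub: "G i \<subseteq> space (M i)" if "i \<in> I" for i using G[OF that] by (rule sets.sets_into_space)
    have [measurable]: "Pi\<^sub>E I G \<in> sets P" using G finite_index by (intro sets_PiM_I_finite) auto
    have "(\<lambda>(x, z). mix I A x z) -` Pi\<^sub>E I G \<inter> space (P \<Otimes>\<^sub>M P) = Pi\<^sub>E I ?G \<times> Pi\<^sub>E I ?F"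
    proof (rule set_eqI, clarify)
      fix x z
      have "x i \<in> ?G i \<and> z i \<in> ?F i \<longleftrightarrow>
          (if i \<in> A then x i else z i) \<in> G i \<and> x i \<in> space (M i) \<and> z i \<in> space (M i)" if "i \<in> I" for i
        using sub[OF that] by auto
      then show "(x, z) \<in> (\<lambda>(x, z). mix I A x z) -` Pi\<^sub>E I G \<inter> space (P \<Otimes>\<^sub>M P) \<longleftrightarrow>
          (x, z) \<in> Pi\<^sub>E I ?G \<times> Pi\<^sub>E I ?F"
        unfolding vimage_eq Int_iff prod.case mix_in_PiE_iff space_pair_measure mem_Times_iff fst_conv snd_conv
            space_PiM by (simp only: PiE_iff) blast
    qed
    then have "emeasure (distr (P \<Otimes>\<^sub>M P) P (\<lambda>(x, z). mix I A x z)) (Pi\<^sub>E I G) =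
        emeasure (P \<Otimes>\<^sub>M P) (Pi\<^sub>E I ?G \<times> Pi\<^sub>E I ?F)"
      by (simp add: emeasure_distr)
    also have "\<dots> = emeasure P (Pi\<^sub>E I ?G) * emeasure P (Pi\<^sub>E I ?F)"
      using G finite_index by (intro emeasure_pair_P sets_PiM_I_finite) auto
    also have "\<dots> = (\<Prod>i\<in>I. emeasure (M i) (G i))"
      using G by (simp add: measure_times prod.distrib[symmetric] if_distrib M.emeasure_space_1 cong: if_cong)
    finally show ?thesis using G by (simp add: measure_times)
  qed
qed simp_all

lemma prob_space_coupling: "prob_space (coupling I M A)"
proof -
  interpret PP: pair_prob_space P P by (rule pair_prob)
  show ?thesis unfolding coupling_def by (rule PP.P.prob_space_distr) measurable
qed

lemma distr_coupling_fst: "distr (coupling I M A) P fst = P"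
proof -
  interpret PP: pair_prob_space P P by (rule pair_prob)
  have "distr (coupling I M A) P fst = distr (P \<Otimes>\<^sub>M P) P fst"
    unfolding coupling_def by (subst distr_distr) (auto simp: comp_def case_prod_beta)
  also have "\<dots> = P"
    by (rule prob_space.distr_pair_fst[OF prob_P])
  finally show ?thesis .
qed

lemma distr_coupling_snd: "distr (coupling I M A) P snd = P"
  unfolding coupling_def by (subst distr_distr) (auto simp: comp_def case_prod_beta distr_mix[unfolded case_prod_beta])

lemma emeasure_coupling_boxes:
  assumes G: "\<And>i. i \<in> I \<Longrightarrow> G i \<in> sets (M i)" and F: "\<And>i. i \<in> I \<Longrightarrow> F i \<in> sets (M i)"
  shows "emeasure (coupling I M A) (Pi\<^sub>E I G \<times> Pi\<^sub>E I F) =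
    (\<Prod>i\<in>I. if i \<in> A then emeasure (M i) (G i \<inter> F i) else emeasure (M i) (G i) * emeasure (M i) (F i))"
proof -
  interpret PP: pair_prob_space P P by (rule pair_prob)
  let ?G = "\<lambda>i. if i \<in> A then G i \<inter> F i else G i" and ?F = "\<lambda>i. if i \<in> A then space (M i) else F i"
  have sub: "G i \<subseteq> space (M i)" "F i \<subseteq> space (M i)" if "i \<in> I" for i
    using G F that by (auto dest: sets.sets_into_space)
  have [measurable]: "Pi\<^sub>E I G \<in> sets P" "Pi\<^sub>E I F \<in> sets P" using G F finite_index by (auto intro!: sets_PiM_I_finite)
  have "(\<lambda>(x, z). (x, mix I A x z)) -` (Pi\<^sub>E I G \<times> Pi\<^sub>E I F) \<inter> space (P \<Otimes>\<^sub>M P) = Pi\<^sub>E I ?G \<times> Pi\<^sub>E I ?F"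
  proof (rule set_eqI, clarify)
    fix x z
    have "x i \<in> ?G i \<and> z i \<in> ?F i \<longleftrightarrow> x i \<in> G i \<and>
        (if i \<in> A then x i else z i) \<in> F i \<and> x i \<in> space (M i) \<and> z i \<in> space (M i)" if "i \<in> I" for i
      using sub[OF that] by auto
    then show "(x, z) \<in> (\<lambda>(x, z). (x, mix I A x z)) -` (Pi\<^sub>E I G \<times> Pi\<^sub>E I F) \<inter> space (P \<Otimes>\<^sub>M P) \<longleftrightarrow>
        (x, z) \<in> Pi\<^sub>E I ?G \<times> Pi\<^sub>E I ?F"
      unfolding vimage_eq Int_iff prod.case mem_Times_iff fst_conv snd_conv mix_in_PiE_iff space_pair_measure
          space_PiM by (simp only: PiE_iff) blast
  qed
  then have "emeasure (coupling I M A) (Pi\<^sub>E I G \<times> Pi\<^sub>E I F) = emeasure (P \<Otimes>\<^sub>M P) (Pi\<^sub>E I ?G \<times> Pi\<^sub>E I ?F)"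
    unfolding coupling_def by (subst emeasure_distr) auto
  also have "\<dots> = emeasure P (Pi\<^sub>E I ?G) * emeasure P (Pi\<^sub>E I ?F)"
    using G F finite_index by (intro emeasure_pair_P sets_PiM_I_finite) auto
  also have "\<dots> = (\<Prod>i\<in>I. emeasure (M i) (?G i)) * (\<Prod>i\<in>I. emeasure (M i) (?F i))"
    using G F by (subst (1 2) measure_times) auto
  also have "\<dots> = (\<Prod>i\<in>I. if i \<in> A then emeasure (M i) (G i \<inter> F i) else emeasure (M i) (G i) * emeasure (M i) (F i))"
    unfolding prod.distrib[symmetric] by (intro prod.cong) (auto simp: M.emeasure_space_1)
  finally show ?thesis .
qed

lemma measure_coupling_boxes:
  assumes G: "\<And>i. i \<in> I \<Longrightarrow> G i \<in> sets (M i)" and F: "\<And>i. i \<in> I \<Longrightarrow> F i \<in> sets (M i)"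
  shows "measure (coupling I M A) (Pi\<^sub>E I G \<times> Pi\<^sub>E I F) =
    (\<Prod>i\<in>I. if i \<in> A then measure (M i) (G i \<inter> F i) else measure (M i) (G i) * measure (M i) (F i))"
proof -
  interpret C: prob_space "coupling I M A" by (rule prob_space_coupling)
  let ?m = "\<lambda>i. if i \<in> A then measure (M i) (G i \<inter> F i) else measure (M i) (G i) * measure (M i) (F i)"
  have "emeasure (coupling I M A) (Pi\<^sub>E I G \<times> Pi\<^sub>E I F) = (\<Prod>i\<in>I. ennreal (?m i))"
    using emeasure_coupling_boxes[of G F A] G F
    by (simp only: ) (intro prod.cong refl, auto simp: M.emeasure_eq_measure ennreal_mult)
  also have "\<dots> = ennreal (\<Prod>i\<in>I. ?m i)" by (rule prod_ennreal) auto
  finally show ?thesis by (simp add: C.emeasure_eq_measure prod_nonneg)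
qed

lemma coupling_empty: "coupling I M {} = P \<Otimes>\<^sub>M P"
proof -
  have "coupling I M {} = distr (P \<Otimes>\<^sub>M P) (P \<Otimes>\<^sub>M P) (\<lambda>p. p)"
    unfolding coupling_def by (rule distr_cong) (auto simp: space_pair_measure mix_empty)
  then show ?thesis by (simp add: distr_id)
qed

lemma coupling_full: "coupling I M I = distr P (P \<Otimes>\<^sub>M P) (\<lambda>x. (x, x))"
proof -
  have "coupling I M I = distr (P \<Otimes>\<^sub>M P) (P \<Otimes>\<^sub>M P) (\<lambda>p. (fst p, fst p))"
    unfolding coupling_def by (rule distr_cong) (auto simp: space_pair_measure mix_self)
  also have "\<dots> = distr (distr (P \<Otimes>\<^sub>M P) P fst) (P \<Otimes>\<^sub>M P) (\<lambda>x. (x, x))"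
    by (subst distr_distr) (auto simp: comp_def)
  finally show ?thesis by (simp add: prob_space.distr_pair_fst[OF prob_P])
qed

end

section \<open>Products of measure-preserving systems\<close>

text \<open>
  All coordinates are required to be probability spaces with a preserved \<open>T i s\<close>, also those outside
  \<open>I\<close>; only \<open>I\<close> enters the product. No group law in \<open>s\<close> is needed.
\<close>

locale product_system = finite_product_prob_space M I for M :: "'i \<Rightarrow> 'a measure" and I +
  fixes T :: "'i \<Rightarrow> real \<Rightarrow> 'a \<Rightarrow> 'a"
  assumes meas_T [measurable]: "\<And>i s. T i s \<in> measurable (M i) (M i)"
    and pres_T: "\<And>i s. distr (M i) (M i) (T i s) = M i"
begin

abbreviation W where "W s \<equiv> product_flow I T s"

lemma measurable_W [measurable]: "W s \<in> measurable P P"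
  unfolding product_flow_def by measurable

lemma W_box: "x \<in> space P \<Longrightarrow> W s x \<in> Pi\<^sub>E I F \<longleftrightarrow> (\<forall>i\<in>I. T i s (x i) \<in> F i)"
  by (auto simp: product_flow_def PiE_iff)

lemma measure_box_W:
  assumes G: "\<And>i. i \<in> I \<Longrightarrow> G i \<in> sets (M i)" and F: "\<And>i. i \<in> I \<Longrightarrow> F i \<in> sets (M i)"
  shows "measure P {x \<in> space P. x \<in> Pi\<^sub>E I G \<and> W s x \<in> Pi\<^sub>E I F} =
    (\<Prod>i\<in>I. measure (M i) {x \<in> space (M i). x \<in> G i \<and> T i s x \<in> F i})"
proof -
  have "{x \<in> space P. x \<in> Pi\<^sub>E I G \<and> W s x \<in> Pi\<^sub>E I F} =
      Pi\<^sub>E I (\<lambda>i. {x \<in> space (M i). x \<in> G i \<and> T i s x \<in> F i})"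
  proof (rule set_eqI)
    fix x
    have "x \<in> {x \<in> space P. x \<in> Pi\<^sub>E I G \<and> W s x \<in> Pi\<^sub>E I F} \<longleftrightarrow>
        x \<in> space P \<and> x \<in> Pi\<^sub>E I G \<and> (\<forall>i\<in>I. T i s (x i) \<in> F i)"
      using W_box[of x s F] by blast
    then show "x \<in> {x \<in> space P. x \<in> Pi\<^sub>E I G \<and> W s x \<in> Pi\<^sub>E I F} \<longleftrightarrow>
        x \<in> Pi\<^sub>E I (\<lambda>i. {x \<in> space (M i). x \<in> G i \<and> T i s x \<in> F i})"
      unfolding space_PiM PiE_iff mem_Collect_eq by blast
  qed
  moreover have "{x \<in> space (M i). x \<in> G i \<and> T i s x \<in> F i} \<in> sets (M i)" if "i \<in> I" for i
    using G[OF that] F[OF that] by measurable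
  ultimately show ?thesis by (simp add: prob_times)
qed

lemma distr_W: "distr P P (W s) = P"
proof (rule measure_eqI_PiM_finite[OF finite_index, symmetric])
  show "range (\<lambda>_::nat. space P) \<subseteq> prod_algebra I M" "(\<Union>n::nat. space P) = space P"
    using space_in_prod_algebra[of I M] by (auto simp: space_PiM)
  show "emeasure P (Pi\<^sub>E I F) = emeasure (distr P P (W s)) (Pi\<^sub>E I F)"
    if F: "\<And>i. i \<in> I \<Longrightarrow> F i \<in> sets (M i)" for F
  proof -
    have [measurable]: "Pi\<^sub>E I F \<in> sets P" using F finite_index by (intro sets_PiM_I_finite) auto
    have eq: "W s -` Pi\<^sub>E I F \<inter> space P = {x \<in> space P. x \<in> Pi\<^sub>E I (\<lambda>i. space (M i)) \<and> W s x \<in> Pi\<^sub>E I F}"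
      by (auto simp: space_PiM)
    have m: "measure (M i) {x \<in> space (M i). x \<in> space (M i) \<and> T i s x \<in> F i} = measure (M i) (F i)" if "i \<in> I" for i
    proof -
      have "measure (M i) (F i) = measure (distr (M i) (M i) (T i s)) (F i)" by (simp add: pres_T)
      also have "\<dots> = measure (M i) (T i s -` F i \<inter> space (M i))"
        using F[OF that] by (intro measure_distr) auto
      also have "T i s -` F i \<inter> space (M i) = {x \<in> space (M i). x \<in> space (M i) \<and> T i s x \<in> F i}" by auto
      finally show ?thesis by simp
    qed
    have "measure P (W s -` Pi\<^sub>E I F \<inter> space P) = measure P (Pi\<^sub>E I F)"
      unfolding eq by (subst measure_box_W) (use F m in \<open>auto simp: prob_times\<close>)
    then show ?thesis
      by (simp add: emeasure_distr emeasure_eq_measure)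
  qed
qed (simp_all add: emeasure_eq_measure)

lemma mix_W: "mix I A (W s x) (W s z) = W s (mix I A x z)"
  by (auto simp: mix_def product_flow_def fun_eq_iff)

lemma distr_coupling_W:
  "distr (coupling I M A) (P \<Otimes>\<^sub>M P) (map_prod (W s) (W s)) = coupling I M A"
proof -
  have "distr (P \<Otimes>\<^sub>M P) (P \<Otimes>\<^sub>M P) (\<lambda>(x, z). (W s x, W s z)) = distr P P (W s) \<Otimes>\<^sub>M distr P P (W s)"
    by (rule pair_measure_distr[symmetric]) (simp_all add: distr_W prob_space_imp_sigma_finite[OF prob_P])
  then have WW: "distr (P \<Otimes>\<^sub>M P) (P \<Otimes>\<^sub>M P) (\<lambda>(x, z). (W s x, W s z)) = P \<Otimes>\<^sub>M P" by (simp add: distr_W)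
  have "distr (coupling I M A) (P \<Otimes>\<^sub>M P) (map_prod (W s) (W s)) =
      distr (P \<Otimes>\<^sub>M P) (P \<Otimes>\<^sub>M P) (\<lambda>p. (W s (fst p), mix I A (W s (fst p)) (W s (snd p))))"
    unfolding coupling_def
    by (subst distr_distr) (auto simp: comp_def map_prod_def case_prod_beta mix_W intro!: distr_cong)
  also have "\<dots> = distr (distr (P \<Otimes>\<^sub>M P) (P \<Otimes>\<^sub>M P) (\<lambda>(x, z). (W s x, W s z))) (P \<Otimes>\<^sub>M P)
      (\<lambda>(x, z). (x, mix I A x z))"
    by (subst distr_distr) (auto simp: comp_def case_prod_beta)
  finally show ?thesis by (simp only: WW coupling_def)
qed

end

section \<open>Products of partially mixing systems\<close>

text \<open>
  A family of systems that are \<open>a i\<close>-weakly mixing along the same times \<open>t n\<close>, where the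
  convergence is tested on indicators only.
\<close>

locale mixing_family = product_system M I T for M :: "'i \<Rightarrow> 'a measure" and I T +
  fixes t :: "nat \<Rightarrow> real" and a :: "'i \<Rightarrow> real"
  assumes weight_pos: "\<And>i. 0 < a i" "\<And>i. a i < 1"
    and lim_T: "\<And>i G F. G \<in> sets (M i) \<Longrightarrow> F \<in> sets (M i) \<Longrightarrow>
      (\<lambda>n. measure (M i) {x \<in> space (M i). x \<in> G \<and> T i (t n) x \<in> F}) \<longlonglongrightarrow>
        (1 - a i) * measure (M i) (G \<inter> F) + a i * (measure (M i) G * measure (M i) F)"
begin

text \<open>The probability that exactly the coordinates in \<open>I - A\<close> are resampled.\<close>

definition weight :: "'i set \<Rightarrow> real" where
  "weight A = (\<Prod>i\<in>I. if i \<in> A then 1 - a i else a i)"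

text \<open>The limiting self-joining: each coordinate \<open>i\<close> is resampled with probability \<open>a i\<close>, independently.\<close>

definition limit_joining :: "(('i \<Rightarrow> 'a) \<times> ('i \<Rightarrow> 'a)) measure" where
  "limit_joining = mixture (P \<Otimes>\<^sub>M P) (Pow I) weight (coupling I M)"

lemma sets_limit_joining [measurable_cong, simp]: "sets limit_joining = sets (P \<Otimes>\<^sub>M P)"
  and space_limit_joining [simp]: "space limit_joining = space (P \<Otimes>\<^sub>M P)"
  by (simp_all add: limit_joining_def)

lemma weight_gt_0: "0 < weight A"
  unfolding weight_def using weight_pos by (intro prod_pos) auto

text \<open>Expansion of a product of binomials, in terms of \<open>weight\<close>.\<close>

lemma sum_weight:
  "(\<Sum>A\<in>Pow I. weight A * (\<Prod>i\<in>I. if i \<in> A then f i else g i)) = (\<Prod>i\<in>I. (1 - a i) * f i + a i * g i)"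
proof -
  have eq: "weight A * (\<Prod>i\<in>I. if i \<in> A then f i else g i) =
      (\<Prod>i\<in>A. (1 - a i) * f i) * (\<Prod>i\<in>I - A. a i * g i)" if "A \<in> Pow I" for A
  proof -
    have "weight A * (\<Prod>i\<in>I. if i \<in> A then f i else g i) =
        (\<Prod>i\<in>I. if i \<in> A then (1 - a i) * f i else a i * g i)"
      unfolding weight_def prod.distrib[symmetric] by (intro prod.cong) auto
    also have "\<dots> = (\<Prod>i\<in>I \<inter> A. (1 - a i) * f i) * (\<Prod>i\<in>I \<inter> - A. a i * g i)"
      using finite_index by (simp add: prod.If_cases)
    also have "I \<inter> - A = I - A" by auto
    also have "I \<inter> A = A" using that by auto
    finally show ?thesis .
  qed
  show ?thesis unfolding prod_add[OF finite_index] by (rule sum.cong) (simp_all only: eq)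
qed

lemma AE_limit_joining_iff:
  assumes "{p \<in> space (P \<Otimes>\<^sub>M P). Q p} \<in> sets (P \<Otimes>\<^sub>M P)"
  shows "(AE p in limit_joining. Q p) \<longleftrightarrow> (\<forall>A\<in>Pow I. AE p in coupling I M A. Q p)"
  unfolding limit_joining_def
  by (rule AE_mixture_iff) (simp_all only: sets_coupling finite_Pow_iff finite_index weight_gt_0 assms)

lemma emeasure_limit_joining:
  assumes "E \<in> sets (P \<Otimes>\<^sub>M P)"
  shows "emeasure limit_joining E = ennreal (\<Sum>A\<in>Pow I. weight A * measure (coupling I M A) E)"
proof -
  have "emeasure (coupling I M A) E = ennreal (measure (coupling I M A) E)" for A
    using prob_space_coupling[of A] by (simp add: prob_space_def finite_measure.emeasure_eq_measure)
  then have "emeasure limit_joining E = (\<Sum>A\<in>Pow I. ennreal (weight A * measure (coupling I M A) E))"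
    unfolding limit_joining_def using assms
    by (simp add: emeasure_mixture ennreal_mult less_imp_le[OF weight_gt_0])
  also have "\<dots> = ennreal (\<Sum>A\<in>Pow I. weight A * measure (coupling I M A) E)"
    by (rule sum_ennreal) (simp add: less_imp_le[OF weight_gt_0])
  finally show ?thesis .
qed

lemma measure_limit_joining:
  "E \<in> sets (P \<Otimes>\<^sub>M P) \<Longrightarrow> measure limit_joining E = (\<Sum>A\<in>Pow I. weight A * measure (coupling I M A) E)"
  by (simp add: measure_def[of limit_joining] emeasure_limit_joining sum_nonneg less_imp_le[OF weight_gt_0])

lemma prob_space_limit_joining: "prob_space limit_joining"
proof
  have "measure (coupling I M A) (space (P \<Otimes>\<^sub>M P)) = 1" for A
    using prob_space.prob_space[OF prob_space_coupling[of A]] by simp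
  then show "emeasure limit_joining (space limit_joining) = 1"
    using sum_weight[of "\<lambda>_. 1" "\<lambda>_. 1"] by (simp add: emeasure_limit_joining)
qed

lemma distr_limit_joining:
  shows distr_limit_joining_fst: "distr limit_joining P fst = P"
    and distr_limit_joining_snd: "distr limit_joining P snd = P"
proof -
  have sw: "(\<Sum>A\<in>Pow I. ennreal (weight A)) = 1"
    using sum_weight[of "\<lambda>_. 1" "\<lambda>_. 1"]
    by (simp add: sum_ennreal less_imp_le[OF weight_gt_0])
  have eq: "distr limit_joining P f = P"
    if [measurable]: "f \<in> measurable (P \<Otimes>\<^sub>M P) P" and f: "\<And>A. distr (coupling I M A) P f = P" for f
  proof (rule measure_eqI)
    fix E assume "E \<in> sets (distr limit_joining P f)"
    then have [measurable]: "E \<in> sets P" by simp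
    have "emeasure (coupling I M A) (f -` E \<inter> space (P \<Otimes>\<^sub>M P)) = emeasure P E" for A
      by (subst (2) f[of A, symmetric]) (simp add: emeasure_distr)
    then show "emeasure (distr limit_joining P f) E = emeasure P E"
      by (simp add: emeasure_distr limit_joining_def emeasure_mixture sum_distrib_right[symmetric] sw)
  qed simp
  show "distr limit_joining P fst = P" "distr limit_joining P snd = P"
    by (auto intro!: eq simp: distr_coupling_fst distr_coupling_snd)
qed

lemma tendsto_boxes:
  assumes G: "\<And>i. i \<in> I \<Longrightarrow> G i \<in> sets (M i)" and F: "\<And>i. i \<in> I \<Longrightarrow> F i \<in> sets (M i)"
  shows "(\<lambda>n. measure P {x \<in> space P. x \<in> Pi\<^sub>E I G \<and> W (t n) x \<in> Pi\<^sub>E I F}) \<longlonglongrightarrow>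
    measure limit_joining (Pi\<^sub>E I G \<times> Pi\<^sub>E I F)"
proof -
  have [measurable]: "Pi\<^sub>E I G \<in> sets P" "Pi\<^sub>E I F \<in> sets P"
    using G F finite_index by (auto intro!: sets_PiM_I_finite)
  have "measure limit_joining (Pi\<^sub>E I G \<times> Pi\<^sub>E I F) =
      (\<Prod>i\<in>I. (1 - a i) * measure (M i) (G i \<inter> F i) + a i * (measure (M i) (G i) * measure (M i) (F i)))"
    unfolding sum_weight[symmetric]
    by (subst measure_limit_joining, measurable, intro sum.cong refl, subst measure_coupling_boxes) (use G F in auto)
  then show ?thesis
    using lim_T[OF G F] by (auto simp: measure_box_W[OF G F] intro!: tendsto_prod)
qed

text \<open>
  Convergence passes from boxes to all events, first in one argument and then in the other.
\<close>

lemma tendsto_limit_joining: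
  assumes G: "G \<in> sets P" and F: "F \<in> sets P"
  shows "(\<lambda>n. measure P {x \<in> space P. x \<in> G \<and> W (t n) x \<in> F}) \<longlonglongrightarrow> measure limit_joining (G \<times> F)"
proof -
  note b = boxes_generate[OF finite_index, of M]
  interpret L: prob_space limit_joining by (rule prob_space_limit_joining)
  have P: "finite_measure P" by unfold_locales
  have L: "finite_measure limit_joining" by unfold_locales
  have 1: "(\<lambda>n. measure P {x \<in> space P. x \<in> G \<and> W (t n) x \<in> F}) \<longlonglongrightarrow> measure limit_joining (G \<times> F)"
    if G: "G \<in> sets P" and F: "F \<in> boxes I M" for G F
  proof -
    have [measurable]: "F \<in> sets P" using F b by auto
    have [simp]: "A \<inter> (W (t n) -` F \<inter> space P) = {x \<in> space P. x \<in> A \<and> W (t n) x \<in> F}" for A n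
      by auto
    have [simp]: "fst -` A \<inter> (space P \<times> F) = A \<times> F" if "A \<in> sets P" for A
      using sets.sets_into_space[OF that] by auto
    have "(\<lambda>n. measure P ((\<lambda>x. x) -` G \<inter> (W (t n) -` F \<inter> space P))) \<longlonglongrightarrow>
        measure limit_joining (fst -` G \<inter> (space P \<times> F))"
    proof (rule tendsto_measure_vimage_generator[OF P b(1,2,3,4) P _ _ _ L])
      fix A assume A: "A \<in> boxes I M"
      then have "A \<in> sets P" using b(5) by auto
      moreover have "(\<lambda>n. measure P {x \<in> space P. x \<in> A \<and> W (t n) x \<in> F}) \<longlonglongrightarrow> measure limit_joining (A \<times> F)"
        using A F tendsto_boxes by (auto simp: boxes_def)
      ultimately show "(\<lambda>n. measure P ((\<lambda>x. x) -` A \<inter> (W (t n) -` F \<inter> space P))) \<longlonglongrightarrow>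
          measure limit_joining (fst -` A \<inter> (space P \<times> F))"
        by simp
    qed (use G in \<open>auto simp: distr_id\<close>)
    then show ?thesis using G by simp
  qed
  have [measurable]: "G \<in> sets P" by fact
  have [simp]: "W (t n) -` A \<inter> G = {x \<in> space P. x \<in> G \<and> W (t n) x \<in> A}" for A n
    using sets.sets_into_space[OF G] by auto
  have [simp]: "snd -` A \<inter> (G \<times> space P) = G \<times> A" if "A \<in> sets P" for A
    using sets.sets_into_space[OF that] by auto
  have "(\<lambda>n. measure P (W (t n) -` F \<inter> G)) \<longlonglongrightarrow> measure limit_joining (snd -` F \<inter> (G \<times> space P))"
  proof (rule tendsto_measure_vimage_generator[OF P b(1,2,3,4) P _ _ _ L])
    fix A assume "A \<in> boxes I M"
    then show "(\<lambda>n. measure P (W (t n) -` A \<inter> G)) \<longlonglongrightarrow>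
        measure limit_joining (snd -` A \<inter> (G \<times> space P))"
      using G b(5) 1 by auto
  qed (use G F in \<open>auto simp: distr_W\<close>)
  then show ?thesis using F by simp
qed

text \<open>
  The limiting joining dominates a multiple of the product measure, so an invariant event \<open>N\<close>
  satisfies \<open>P N * P (- N) = 0\<close>.
\<close>

lemma ergodic_W:
  assumes N: "N \<in> sets P" and inv: "\<And>n. AE x in P. W (t n) x \<in> N \<longleftrightarrow> x \<in> N"
  shows "measure P N = 0 \<or> measure P N = 1"
proof -
  let ?N = "space P - N"
  have [measurable]: "N \<in> sets P" by fact
  have z: "measure P {x \<in> space P. x \<in> N \<and> W (t n) x \<in> ?N} = 0" for n
  proof -
    have "AE x in P. \<not> (x \<in> N \<and> W (t n) x \<in> ?N)" using inv[of n] by eventually_elim auto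
    then have "emeasure P {x \<in> space P. x \<in> N \<and> W (t n) x \<in> ?N} = 0" by (rule emeasure_eq_0_AE)
    then show ?thesis by (simp add: measure_def)
  qed
  have "(\<lambda>n. 0) \<longlonglongrightarrow> measure limit_joining (N \<times> ?N)"
    using tendsto_limit_joining[of N ?N] z by simp
  then have "measure limit_joining (N \<times> ?N) = 0" by (simp add: LIMSEQ_const_iff)
  then have "(\<Sum>A\<in>Pow I. weight A * measure (coupling I M A) (N \<times> ?N)) = 0"
    by (subst (asm) measure_limit_joining) auto
  then have "weight {} * measure (coupling I M {}) (N \<times> ?N) = 0"
    using finite_index by (subst (asm) sum_nonneg_eq_0_iff) (auto simp: less_imp_le[OF weight_gt_0])
  then have "measure (P \<Otimes>\<^sub>M P) (N \<times> ?N) = 0"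
    using weight_gt_0[of "{}"] by (simp add: coupling_empty)
  then have "measure P N * measure P ?N = 0"
    by (simp add: measure_def emeasure_pair_P enn2real_mult)
  then show ?thesis
    using prob_compl[of N] by auto
qed

text \<open>
  Each coupling is a factor of the direct square of the product system. That square is again the
  product of a partially mixing family, now indexed by \<open>I \<times> UNIV\<close>.
\<close>

lemma ergodic_coupling:
  assumes N: "N \<in> sets (P \<Otimes>\<^sub>M P)"
    and inv: "\<And>n. AE p in coupling I M A. map_prod (W (t n)) (W (t n)) p \<in> N \<longleftrightarrow> p \<in> N"
  shows "measure (coupling I M A) N = 0 \<or> measure (coupling I M A) N = 1"
proof -
  let ?M = "\<lambda>k. M (fst k)" and ?I = "I \<times> (UNIV :: bool set)"
  interpret D: mixing_family ?M ?I "\<lambda>k. T (fst k)" t "\<lambda>k. a (fst k)"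
    by unfold_locales (auto simp: pres_T weight_pos lim_T finite_index)
  define \<theta> where "\<theta> = (\<lambda>v :: 'i \<times> bool \<Rightarrow> 'a. (\<lambda>i\<in>I. v (i, True), \<lambda>i\<in>I. v (i, False)))"
  have c: "(\<lambda>v. v (i, b)) \<in> measurable D.P (M i)" if "i \<in> I" for i b
    using measurable_component_singleton[of "(i, b)" ?I ?M] that by simp
  have [measurable]: "\<theta> \<in> measurable D.P (P \<Otimes>\<^sub>M P)"
    unfolding \<theta>_def using c by (intro measurable_Pair measurable_restrict) auto
  have \<theta>: "distr D.P (P \<Otimes>\<^sub>M P) \<theta> = P \<Otimes>\<^sub>M P"
  proof (rule measure_eqI_pair_boxes[OF finite_index finite_index])
    show "finite_measure (distr D.P (P \<Otimes>\<^sub>M P) \<theta>)" by (rule D.P.finite_measure_distr) measurable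
    fix G F assume G: "\<And>i. i \<in> I \<Longrightarrow> G i \<in> sets (M i)" and F: "\<And>i. i \<in> I \<Longrightarrow> F i \<in> sets (M i)"
    have [measurable]: "Pi\<^sub>E I G \<in> sets P" "Pi\<^sub>E I F \<in> sets P"
      using G F finite_index by (auto intro!: sets_PiM_I_finite)
    have sub: "G i \<subseteq> space (M i)" "F i \<subseteq> space (M i)" if "i \<in> I" for i
      using G F that by (auto dest: sets.sets_into_space)
    let ?H = "\<lambda>k. if snd k then G (fst k) else F (fst k)"
    have "\<theta> -` (Pi\<^sub>E I G \<times> Pi\<^sub>E I F) \<inter> space D.P = Pi\<^sub>E ?I ?H"
    proof (rule set_eqI)
      fix v
      have e1: "(\<forall>i\<in>I. v (i, True) \<in> G i) \<and> (\<forall>i\<in>I. v (i, False) \<in> F i) \<longleftrightarrow> (\<forall>k\<in>?I. v k \<in> ?H k)"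
        by (auto simp: all_bool_eq Ball_def)
      have e2: "\<forall>k\<in>?I. v k \<in> space (?M k)" if "\<forall>k\<in>?I. v k \<in> ?H k"
      proof
        fix k assume "k \<in> ?I"
        then show "v k \<in> space (?M k)" using that[rule_format, of k] sub[of "fst k"] by (auto split: if_splits)
      qed
      have e3: "\<theta> v \<in> Pi\<^sub>E I G \<times> Pi\<^sub>E I F \<longleftrightarrow> (\<forall>i\<in>I. v (i, True) \<in> G i) \<and> (\<forall>i\<in>I. v (i, False) \<in> F i)"
        by (auto simp: \<theta>_def PiE_iff)
      show "v \<in> \<theta> -` (Pi\<^sub>E I G \<times> Pi\<^sub>E I F) \<inter> space D.P \<longleftrightarrow> v \<in> Pi\<^sub>E ?I ?H"
        unfolding vimage_eq Int_iff space_PiM PiE_iff e3 e1 using e2 by argo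
    qed
    then have "emeasure (distr D.P (P \<Otimes>\<^sub>M P) \<theta>) (Pi\<^sub>E I G \<times> Pi\<^sub>E I F) = emeasure D.P (Pi\<^sub>E ?I ?H)"
      by (simp add: emeasure_distr)
    also have "\<dots> = (\<Prod>k\<in>?I. emeasure (?M k) (?H k))"
      using G F by (intro D.measure_times) auto
    also have "\<dots> = (\<Prod>i\<in>I. \<Prod>b\<in>UNIV. emeasure (M i) (if b then G i else F i))"
      by (subst prod.cartesian_product) (auto intro!: prod.cong)
    also have "\<dots> = emeasure P (Pi\<^sub>E I G) * emeasure P (Pi\<^sub>E I F)"
      using G F by (simp add: measure_times prod.distrib UNIV_bool mult.commute)
    finally show "emeasure (distr D.P (P \<Otimes>\<^sub>M P) \<theta>) (Pi\<^sub>E I G \<times> Pi\<^sub>E I F) =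
        emeasure (P \<Otimes>\<^sub>M P) (Pi\<^sub>E I G \<times> Pi\<^sub>E I F)" by (simp add: emeasure_pair_P)
  qed simp_all
  define \<eta> where "\<eta> = (\<lambda>(x, z). (x, mix I A x z)) \<circ> \<theta>"
  have [measurable]: "\<eta> \<in> measurable D.P (P \<Otimes>\<^sub>M P)"
    unfolding \<eta>_def by (rule measurable_comp) measurable
  have \<eta>: "coupling I M A = distr D.P (P \<Otimes>\<^sub>M P) \<eta>"
    unfolding coupling_def \<eta>_def by (subst (1) \<theta>[symmetric], subst distr_distr) auto
  have eq: "\<eta> (D.W s v) = map_prod (W s) (W s) (\<eta> v)" for s v
    by (auto simp: \<eta>_def \<theta>_def product_flow_def mix_def fun_eq_iff)
  have N' [measurable]: "\<eta> -` N \<inter> space D.P \<in> sets D.P" using N by measurable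
  have "measure D.P (\<eta> -` N \<inter> space D.P) = 0 \<or> measure D.P (\<eta> -` N \<inter> space D.P) = 1"
  proof (rule D.ergodic_W[OF N'])
    fix n
    have "AE v in D.P. map_prod (W (t n)) (W (t n)) (\<eta> v) \<in> N \<longleftrightarrow> \<eta> v \<in> N"
      using inv[of n] unfolding \<eta> by (rule AE_distrD[rotated]) measurable
    then show "AE v in D.P. D.W (t n) v \<in> \<eta> -` N \<inter> space D.P \<longleftrightarrow> v \<in> \<eta> -` N \<inter> space D.P"
      using AE_space by eventually_elim (use measurable_space[OF D.measurable_W[of "t n"]] in \<open>auto simp: eq\<close>)
  qed
  then show ?thesis using N unfolding \<eta> by (simp add: measure_distr)
qed

end

section \<open>Separation in standard Borel spaces\<close>

text \<open>A countable family of events separating the points of the space.\<close>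

definition separates :: "'a set set \<Rightarrow> 'a measure \<Rightarrow> bool" where
  "separates \<U> M \<longleftrightarrow> countable \<U> \<and> \<U> \<subseteq> sets M \<and>
     (\<forall>x\<in>space M. \<forall>y\<in>space M. (\<forall>U\<in>\<U>. x \<in> U \<longleftrightarrow> y \<in> U) \<longrightarrow> x = y)"

lemma standard_borel_separates:
  assumes "standard_borel M"
  obtains \<U> where "separates \<U> M"
proof -
  obtain \<tau> where \<tau>: "completely_metrizable_space \<tau>" "second_countable \<tau>" "topspace \<tau> = space M"
    "sets M = sigma_sets (space M) {U. openin \<tau> U}"
    using assms by (auto simp: standard_borel_def)
  from \<tau>(1) have H: "Hausdorff_space \<tau>"
    by (simp add: completely_metrizable_imp_metrizable_space metrizable_imp_Hausdorff_space)
  obtain \<B> where \<B>: "countable \<B>" "\<And>V. V \<in> \<B> \<Longrightarrow> openin \<tau> V"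
    "\<And>U x. openin \<tau> U \<Longrightarrow> x \<in> U \<Longrightarrow> \<exists>V\<in>\<B>. x \<in> V \<and> V \<subseteq> U"
    using \<tau>(2) by (auto simp: second_countable_def)
  have "x = y" if xy: "x \<in> space M" "y \<in> space M" "\<forall>U\<in>\<B>. x \<in> U \<longleftrightarrow> y \<in> U" for x y
  proof (rule ccontr)
    assume "x \<noteq> y"
    with H xy \<tau>(3) obtain U V where "openin \<tau> U" "openin \<tau> V" "x \<in> U" "y \<in> V" "disjnt U V"
      unfolding Hausdorff_space_def by metis
    with \<B>(3)[of U x] xy(3) show False by (auto simp: disjnt_iff)
  qed
  then have "separates \<B> M" using \<B>(1,2) \<tau>(4) by (auto simp: separates_def)
  then show ?thesis by (rule that)
qed

lemma (in prob_space) AE_imp_ex: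
  assumes "AE x in M. Q x"
  shows "\<exists>x\<in>space M. Q x"
proof (rule ccontr)
  assume neg: "\<not> ?thesis"
  have "AE x in M. False" using assms AE_space by eventually_elim (use neg in blast)
  then show False by simp
qed

text \<open>
  If every event had measure 0 or 1, then the intersection of the separating events (or their
  complements) of measure 1 would be a single point of full measure.
\<close>

lemma (in flow) nontrivial_event:
  obtains U where "U \<in> sets M" "measure M U \<noteq> 0" "measure M U \<noteq> 1"
proof -
  have "\<exists>U\<in>sets M. measure M U \<noteq> 0 \<and> measure M U \<noteq> 1"
  proof (rule ccontr)
    assume "\<not> ?thesis"
    then have 01: "measure M U = 0 \<or> measure M U = 1" if "U \<in> sets M" for U using that by blast
    obtain \<U> where \<U>: "separates \<U> M" using standard standard_borel_separates by blast
    then have c: "countable \<U>" and s: "\<U> \<subseteq> sets M" by (auto simp: separates_def)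
    have "AE x in M. x \<in> U \<longleftrightarrow> measure M U = 1" if "U \<in> \<U>" for U
    proof (cases "measure M U = 1")
      case True
      then show ?thesis using s that by (auto simp: prob_eq_1)
    next
      case False
      then have "U \<in> null_sets M" using 01[of U] s that by (auto simp: null_sets_def emeasure_eq_measure)
      then show ?thesis using False by (auto dest: AE_not_in)
    qed
    then have ae: "AE x in M. \<forall>U\<in>\<U>. x \<in> U \<longleftrightarrow> measure M U = 1" using c by (simp add: AE_ball_countable)
    from AE_imp_ex[OF this] obtain x where x: "x \<in> space M" "\<forall>U\<in>\<U>. x \<in> U \<longleftrightarrow> measure M U = 1" by blast
    have "AE y in M. y = x"
      using ae AE_space by eventually_elim (use x \<U> in \<open>auto simp: separates_def\<close>)
    with x(1) nontrivial show False by blast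
  qed
  then show ?thesis using that by blast
qed

section \<open>Events that depend on a set of coordinates\<close>

lemma sets_AE_section:
  assumes B: "sigma_finite_measure B" and E: "E \<in> sets (A \<Otimes>\<^sub>M B)"
  shows "{x \<in> space A. AE y in B. (x, y) \<notin> E} \<in> sets A"
proof -
  interpret sigma_finite_measure B by fact
  have "(AE y in B. (x, y) \<notin> E) \<longleftrightarrow> emeasure B (Pair x -` E) = 0" if "x \<in> space A" for x
  proof -
    have [measurable]: "Pair x -` E \<in> sets B" using E by (rule sets_Pair1)
    have "(AE y in B. (x, y) \<notin> E) \<longleftrightarrow> (AE y in B. y \<notin> Pair x -` E)" by simp
    also have "\<dots> \<longleftrightarrow> emeasure B (Pair x -` E) = 0"
      by (subst AE_iff_null_sets[symmetric]) (auto simp: null_sets_def)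
    finally show ?thesis .
  qed
  then have "{x \<in> space A. AE y in B. (x, y) \<notin> E} = {x \<in> space A. emeasure B (Pair x -` E) = 0}" by auto
  also have "\<dots> \<in> sets A" using measurable_emeasure_Pair[OF E] by measurable
  finally show ?thesis .
qed

context finite_product_prob_space
begin

lemma AE_P_pair_iff:
  assumes "{p \<in> space (P \<Otimes>\<^sub>M P). Q p} \<in> sets (P \<Otimes>\<^sub>M P)"
  shows "(AE p in P \<Otimes>\<^sub>M P. Q p) \<longleftrightarrow> (AE x in P. AE z in P. Q (x, z))"
proof -
  interpret PP: pair_prob_space P P by (rule pair_prob)
  show ?thesis using PP.AE_pair_iff[of "\<lambda>x z. Q (x, z)"] assms by simp
qed

lemma AE_coupling_iff:
  assumes Q: "{p \<in> space (P \<Otimes>\<^sub>M P). Q p} \<in> sets (P \<Otimes>\<^sub>M P)"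
  shows "(AE p in coupling I M A. Q p) \<longleftrightarrow> (AE x in P. AE z in P. Q (x, mix I A x z))"
proof -
  have "(AE p in coupling I M A. Q p) \<longleftrightarrow> (AE p in P \<Otimes>\<^sub>M P. Q ((\<lambda>(x, z). (x, mix I A x z)) p))"
    unfolding coupling_def using Q by (intro AE_distr_iff measurable_coupling_map)
  also have "\<dots> \<longleftrightarrow> (AE x in P. AE z in P. Q (x, mix I A x z))"
  proof (subst AE_P_pair_iff)
    have "{p \<in> space (P \<Otimes>\<^sub>M P). Q ((\<lambda>(x, z). (x, mix I A x z)) p)} =
        (\<lambda>(x, z). (x, mix I A x z)) -` {p \<in> space (P \<Otimes>\<^sub>M P). Q p} \<inter> space (P \<Otimes>\<^sub>M P)"
      using measurable_space[OF measurable_coupling_map] by blast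
    also have "\<dots> \<in> sets (P \<Otimes>\<^sub>M P)" by (rule measurable_sets[OF measurable_coupling_map Q])
    finally show "{p \<in> space (P \<Otimes>\<^sub>M P). Q ((\<lambda>(x, z). (x, mix I A x z)) p)} \<in> sets (P \<Otimes>\<^sub>M P)" .
  qed simp
  finally show ?thesis .
qed

lemma AE_mixI:
  assumes "AE y in P. R y"
  shows "AE x in P. AE z in P. R (mix I A x z)"
proof -
  interpret PP: pair_prob_space P P by (rule pair_prob)
  have "AE p in P \<Otimes>\<^sub>M P. R ((\<lambda>(x, z). mix I A x z) p)"
    by (rule AE_distrD[where M'=P]) (measurable, simp only: distr_mix assms)
  from PP.AE_pair[OF this] show ?thesis by simp
qed

lemma AE_mixD:
  assumes ae: "AE x in P. AE z in P. R (mix I A x z)" and R: "{y \<in> space P. R y} \<in> sets P"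
  shows "AE y in P. R y"
proof -
  have m: "(\<lambda>(x, z). mix I A x z) \<in> measurable (P \<Otimes>\<^sub>M P) P" by measurable
  have "{p \<in> space (P \<Otimes>\<^sub>M P). R ((\<lambda>(x, z). mix I A x z) p)} =
      (\<lambda>(x, z). mix I A x z) -` {y \<in> space P. R y} \<inter> space (P \<Otimes>\<^sub>M P)"
    using measurable_space[OF m] by blast
  also have "\<dots> \<in> sets (P \<Otimes>\<^sub>M P)" by (rule measurable_sets[OF m R])
  finally have "AE p in P \<Otimes>\<^sub>M P. R ((\<lambda>(x, z). mix I A x z) p)"
    using ae by (subst AE_P_pair_iff) simp_all
  then have "AE y in distr (P \<Otimes>\<^sub>M P) P (\<lambda>(x, z). mix I A x z). R y"
    by (subst AE_distr_iff[OF m R])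
  then show ?thesis by (simp only: distr_mix)
qed

text \<open>
  Up to null sets, \<open>G\<close> is measurable with respect to the coordinates in \<open>A\<close>: resampling the other
  coordinates does not change membership in \<open>G\<close>.
\<close>

definition depends_on :: "'a set \<Rightarrow> ('a \<Rightarrow> 'b) set \<Rightarrow> bool" where
  "depends_on A G \<longleftrightarrow> (AE p in coupling I M A. fst p \<in> G \<longleftrightarrow> snd p \<in> G)"

lemma depends_on_iff:
  assumes [measurable]: "G \<in> sets P"
  shows "depends_on A G \<longleftrightarrow> (AE x in P. AE z in P. x \<in> G \<longleftrightarrow> mix I A x z \<in> G)"
proof -
  have "{p \<in> space (P \<Otimes>\<^sub>M P). fst p \<in> G \<longleftrightarrow> snd p \<in> G} \<in> sets (P \<Otimes>\<^sub>M P)" by measurable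
  from AE_coupling_iff[OF this] show ?thesis by (simp add: depends_on_def)
qed

lemma depends_on_mono:
  assumes G: "G \<in> sets P" and A: "depends_on A G" "A \<subseteq> A'"
  shows "depends_on A' G"
proof -
  have 1: "AE x in P. AE z in P. x \<in> G \<longleftrightarrow> mix I A x z \<in> G" using G A by (simp add: depends_on_iff)
  from AE_mixI[OF 1, of A']
  have 2: "AE x in P. AE v in P. AE z in P. mix I A' x v \<in> G \<longleftrightarrow> mix I A x z \<in> G"
    by (simp only: mix_mix_left_mono[OF A(2)])
  have "AE x in P. AE v in P. x \<in> G \<longleftrightarrow> mix I A' x v \<in> G"
    using 1 2
  proof eventually_elim
    case (elim x)
    from elim(2) show ?case
    proof eventually_elim
      case (elim v)
      have "AE z in P. x \<in> G \<longleftrightarrow> mix I A' x v \<in> G"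
        using elim \<open>AE z in P. x \<in> G \<longleftrightarrow> mix I A x z \<in> G\<close> by eventually_elim simp
      then show ?case by simp
    qed
  qed
  then show ?thesis using G by (simp add: depends_on_iff)
qed

text \<open>
  Resampling off \<open>A\<close> and then off \<open>A'\<close> is the same as resampling off \<open>A \<inter> A'\<close>.
\<close>

lemma depends_on_Int:
  assumes G: "G \<in> sets P" and A: "depends_on A G" "depends_on A' G"
  shows "depends_on (A \<inter> A') G"
proof -
  have 1: "AE x in P. AE z in P. x \<in> G \<longleftrightarrow> mix I A x z \<in> G" using G A by (simp add: depends_on_iff)
  have "AE x in P. AE z in P. x \<in> G \<longleftrightarrow> mix I A' x z \<in> G" using G A by (simp add: depends_on_iff)
  from AE_mixI[OF this, of A]
  have 2: "AE x in P. AE z in P. AE u in P. mix I A x z \<in> G \<longleftrightarrow> mix I (A \<inter> A') x (mix I A' z u) \<in> G"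
    by (simp only: mix_mix_left)
  have "AE x in P. AE y in P. x \<in> G \<longleftrightarrow> mix I (A \<inter> A') x y \<in> G"
    using 1 2 AE_space
  proof eventually_elim
    case (elim x)
    have "AE z in P. AE u in P. x \<in> G \<longleftrightarrow> mix I (A \<inter> A') x (mix I A' z u) \<in> G"
      using elim(1,2) by eventually_elim simp
    moreover have "{y \<in> space P. x \<in> G \<longleftrightarrow> mix I (A \<inter> A') x y \<in> G} \<in> sets P"
      using G elim(3) by measurable
    ultimately show ?case by (rule AE_mixD)
  qed
  then show ?thesis using G by (simp add: depends_on_iff)
qed

lemma depends_on_INT:
  assumes "finite \<A>" "\<A> \<noteq> {}" and G: "G \<in> sets P" and "\<And>A. A \<in> \<A> \<Longrightarrow> depends_on A G"
  shows "depends_on (\<Inter>\<A>) G"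
  using assms(1,2,4) by (induction \<A> rule: finite_ne_induct) (auto intro: depends_on_Int[OF G])

text \<open>The event that the coordinate \<open>i\<close> lies in \<open>U\<close>.\<close>

definition cylinder :: "'a \<Rightarrow> 'b set \<Rightarrow> ('a \<Rightarrow> 'b) set" where
  "cylinder i U = {x \<in> space P. x i \<in> U}"

lemma sets_cylinder [measurable (raw)]: "i \<in> I \<Longrightarrow> U \<in> sets (M i) \<Longrightarrow> cylinder i U \<in> sets P"
  unfolding cylinder_def
  using measurable_sets[OF measurable_component_singleton[of i I M], of U] by (simp add: vimage_def Int_def conj_commute)

lemma cylinder_eq_PiE:
  assumes "i \<in> I" "U \<in> sets (M i)"
  shows "cylinder i U = Pi\<^sub>E I (\<lambda>k. if k = i then U else space (M k))"
proof (rule set_eqI)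
  fix x
  have "(\<forall>k\<in>I. x k \<in> (if k = i then U else space (M k))) \<longleftrightarrow> x i \<in> U \<and> (\<forall>k\<in>I. x k \<in> space (M k))"
    using sets.sets_into_space[OF assms(2)] assms(1) by auto
  then show "x \<in> cylinder i U \<longleftrightarrow> x \<in> Pi\<^sub>E I (\<lambda>k. if k = i then U else space (M k))"
    unfolding cylinder_def space_PiM PiE_iff mem_Collect_eq by blast
qed

lemma depends_on_cylinder:
  assumes i: "i \<in> I" and U: "U \<in> sets (M i)" and A: "i \<in> A"
  shows "depends_on A (cylinder i U)"
proof -
  have "x \<in> cylinder i U \<longleftrightarrow> mix I A x z \<in> cylinder i U" if "x \<in> space P" "z \<in> space P" for x z
    using mix_space[OF that, of A] that i A by (auto simp: cylinder_def mix_def)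
  then show ?thesis by (auto simp: depends_on_iff[OF sets_cylinder[OF i U]])
qed

lemma not_depends_on_cylinder:
  assumes i: "i \<in> I" and U: "U \<in> sets (M i)" "measure (M i) U \<noteq> 0" "measure (M i) U \<noteq> 1" and A: "i \<notin> A"
  shows "\<not> depends_on A (cylinder i U)"
proof
  assume "depends_on A (cylinder i U)"
  then have "AE x in P. AE z in P. x \<in> cylinder i U \<longleftrightarrow> mix I A x z \<in> cylinder i U"
    using i U by (simp add: depends_on_iff sets_cylinder)
  then obtain x where x: "x \<in> space P" and ae: "AE z in P. x \<in> cylinder i U \<longleftrightarrow> mix I A x z \<in> cylinder i U"
    using prob_space.AE_imp_ex[OF prob_P] by blast
  have ae: "AE z in P. z \<in> cylinder i U \<longleftrightarrow> x \<in> cylinder i U"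
    using ae AE_space by eventually_elim (use x i A mix_space[OF x] in \<open>auto simp: cylinder_def mix_def\<close>)
  have [measurable]: "cylinder i U \<in> sets P" using i U by (simp add: sets_cylinder)
  have "cylinder i U = Pi\<^sub>E I (\<lambda>k. if k = i then U else space (M k))"
    using i U(1) by (rule cylinder_eq_PiE)
  then have "measure P (cylinder i U) = (\<Prod>k\<in>I. measure (M k) (if k = i then U else space (M k)))"
    using U by (simp add: prob_times)
  also have "\<dots> = (\<Prod>k\<in>I. if k = i then measure (M i) U else 1)"
    by (intro prod.cong) (auto simp: M.prob_space)
  also have "\<dots> = measure (M i) U" using i finite_index by simp
  finally have m: "measure P (cylinder i U) = measure (M i) U" .
  show False
  proof (cases "x \<in> cylinder i U")
    case True
    then have "measure P (cylinder i U) = 1"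
      using ae by (simp add: prob_space.prob_eq_1[OF prob_P])
    with m U(3) show False by simp
  next
    case False
    then have "AE z in P. z \<notin> cylinder i U" using ae by simp
    then have "cylinder i U \<in> null_sets P" by (simp add: AE_iff_null_sets)
    then have "measure P (cylinder i U) = 0" by (simp add: null_sets_def measure_def)
    with m U(2) show False by simp
  qed
qed

text \<open>
  A map for which the preimages of countably many separating events depend on the coordinate \<open>j\<close>
  factors through this coordinate almost everywhere: freeze the other coordinates at a generic point.
\<close>

lemma factors_through_coordinate:
  assumes j: "j \<in> I" and h: "h \<in> measurable P N" and \<U>: "separates \<U> N"
    and dep: "\<And>U. U \<in> \<U> \<Longrightarrow> depends_on {j} (h -` U \<inter> space P)"
  obtains \<phi> where "\<phi> \<in> measurable (M j) N" "AE x in P. h x = \<phi> (x j)"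
proof -
  interpret PP: pair_prob_space P P by (rule pair_prob)
  have c: "countable \<U>" and s: "\<And>U. U \<in> \<U> \<Longrightarrow> U \<in> sets N" using \<U> by (auto simp: separates_def)
  have "AE z in P. AE x in P. h x \<in> U \<longleftrightarrow> h (mix I {j} x z) \<in> U" if U: "U \<in> \<U>" for U
  proof -
    have [measurable]: "U \<in> sets N" "h \<in> measurable P N" using s[OF U] h by auto
    have "AE x in P. AE z in P. x \<in> h -` U \<inter> space P \<longleftrightarrow> mix I {j} x z \<in> h -` U \<inter> space P"
      using dep[OF U] by (subst (asm) depends_on_iff) auto
    then have "AE x in P. AE z in P. h x \<in> U \<longleftrightarrow> h (mix I {j} x z) \<in> U"
      using AE_space
    proof eventually_elim
      case (elim x)
      from elim(1) AE_space show ?case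
        by eventually_elim (use elim(2) mix_space[of x I M] in auto)
    qed
    then show ?thesis
      by (subst (asm) PP.AE_commute) measurable
  qed
  then have "AE z in P. \<forall>U\<in>\<U>. AE x in P. h x \<in> U \<longleftrightarrow> h (mix I {j} x z) \<in> U"
    using c by (simp add: AE_ball_countable)
  then obtain z where z: "z \<in> space P" and ae: "\<forall>U\<in>\<U>. AE x in P. h x \<in> U \<longleftrightarrow> h (mix I {j} x z) \<in> U"
    using prob_space.AE_imp_ex[OF prob_P] by blast
  have ae: "AE x in P. \<forall>U\<in>\<U>. h x \<in> U \<longleftrightarrow> h (mix I {j} x z) \<in> U"
    using ae c by (simp add: AE_ball_countable)
  define \<phi> where "\<phi> = (\<lambda>u. h (\<lambda>i\<in>I. if i = j then u else z i))"
  have "(\<lambda>u. \<lambda>i\<in>I. if i = j then u else z i) \<in> measurable (M j) P"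
  proof (rule measurable_restrict)
    fix i assume "i \<in> I"
    then show "(\<lambda>u. if i = j then u else z i) \<in> measurable (M j) (M i)"
      using z by (cases "i = j") (auto simp: space_PiM PiE_iff)
  qed
  from measurable_compose[OF this h] have "\<phi> \<in> measurable (M j) N" by (simp add: \<phi>_def)
  moreover have "AE x in P. h x = \<phi> (x j)"
    using ae AE_space
  proof eventually_elim
    case (elim x)
    have "mix I {j} x z = (\<lambda>i\<in>I. if i = j then x j else z i)" by (auto simp: mix_def)
    moreover have "h x \<in> space N" "h (mix I {j} x z) \<in> space N"
      using elim(2) mix_space[OF elim(2) z] h by (auto intro: measurable_space)
    ultimately show ?case using elim(1) \<U> by (simp add: \<phi>_def separates_def)
  qed
  ultimately show ?thesis by (rule that)
qed

end

lemma (in product_system) measure_cylinder_W: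
  assumes j: "j \<in> I" and U: "U \<in> sets (M j)" and V: "V \<in> sets (M j)"
  shows "measure P {x \<in> space P. x \<in> cylinder j U \<and> W s x \<in> cylinder j V} =
    measure (M j) {x \<in> space (M j). x \<in> U \<and> T j s x \<in> V}"
proof -
  let ?f = "\<lambda>A k. if k = j then A else space (M k)"
  have "measure P {x \<in> space P. x \<in> cylinder j U \<and> W s x \<in> cylinder j V} =
      (\<Prod>i\<in>I. measure (M i) {x \<in> space (M i). x \<in> ?f U i \<and> T i s x \<in> ?f V i})"
    unfolding cylinder_eq_PiE[OF j U] cylinder_eq_PiE[OF j V]
    by (rule measure_box_W) (use U V in auto)
  also have "\<dots> = (\<Prod>i\<in>I. if i = j then measure (M j) {x \<in> space (M j). x \<in> U \<and> T j s x \<in> V} else 1)"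
  proof (rule prod.cong, rule refl)
    fix i assume "i \<in> I"
    have "{x \<in> space (M i). T i s x \<in> space (M i)} = space (M i)"
      using measurable_space[OF meas_T] by blast
    then show "measure (M i) {x \<in> space (M i). x \<in> ?f U i \<and> T i s x \<in> ?f V i} =
        (if i = j then measure (M j) {x \<in> space (M j). x \<in> U \<and> T j s x \<in> V} else 1)"
      by (simp add: M.prob_space)
  qed
  also have "\<dots> = measure (M j) {x \<in> space (M j). x \<in> U \<and> T j s x \<in> V}"
    using j finite_index by simp
  finally show ?thesis .
qed

section \<open>Isomorphic products\<close>

text \<open>
  An isomorphism \<open>\<Phi>\<close>, with inverse \<open>\<Psi>\<close> up to null sets, from the product of the systems \<open>N j\<close> onto the
  product of the systems \<open>M i\<close>. Mixing is assumed of the \<open>M i\<close> only.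
\<close>

locale product_isomorphism = X: mixing_family M I T t a + Y: product_system N I S
  for M :: "'i \<Rightarrow> 'a measure" and I T t a and N :: "'i \<Rightarrow> 'b measure" and S +
  fixes \<Phi> :: "('i \<Rightarrow> 'b) \<Rightarrow> ('i \<Rightarrow> 'a)" and \<Psi> :: "('i \<Rightarrow> 'a) \<Rightarrow> ('i \<Rightarrow> 'b)"
  assumes meas_\<Phi> [measurable]: "\<Phi> \<in> measurable (PiM I N) (PiM I M)"
    and distr_\<Phi>: "distr (PiM I N) (PiM I M) \<Phi> = PiM I M"
    and meas_\<Psi> [measurable]: "\<Psi> \<in> measurable (PiM I M) (PiM I N)"
    and \<Psi>_\<Phi>: "AE y in PiM I N. \<Psi> (\<Phi> y) = y"
    and \<Phi>_\<Psi>: "AE x in PiM I M. \<Phi> (\<Psi> x) = x"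
    and intertwine: "\<And>s. AE y in PiM I N. product_flow I T s (\<Phi> y) = \<Phi> (product_flow I S s y)"
begin

lemma distr_\<Psi>: "distr X.P Y.P \<Psi> = Y.P"
proof -
  have "distr X.P Y.P \<Psi> = distr (distr Y.P X.P \<Phi>) Y.P \<Psi>" by (simp only: distr_\<Phi>)
  also have "\<dots> = distr Y.P Y.P (\<lambda>y. \<Psi> (\<Phi> y))" by (subst distr_distr) (auto simp: comp_def)
  also have "\<dots> = distr Y.P Y.P (\<lambda>y. y)"
    using \<Psi>_\<Phi> by (intro distr_cong_AE) auto
  finally show ?thesis by (simp add: distr_id)
qed

lemma meas_\<Phi>\<Phi> [measurable]: "map_prod \<Phi> \<Phi> \<in> measurable (Y.P \<Otimes>\<^sub>M Y.P) (X.P \<Otimes>\<^sub>M X.P)"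
  and meas_\<Psi>\<Psi> [measurable]: "map_prod \<Psi> \<Psi> \<in> measurable (X.P \<Otimes>\<^sub>M X.P) (Y.P \<Otimes>\<^sub>M Y.P)"
  unfolding map_prod_def by measurable

text \<open>The limiting joining, transported by \<open>\<Psi>\<close> to the product of the \<open>N j\<close>.\<close>

definition limit_joining_Y :: "(('i \<Rightarrow> 'b) \<times> ('i \<Rightarrow> 'b)) measure" where
  "limit_joining_Y = distr X.limit_joining (Y.P \<Otimes>\<^sub>M Y.P) (map_prod \<Psi> \<Psi>)"

lemma sets_limit_joining_Y [measurable_cong, simp]: "sets limit_joining_Y = sets (Y.P \<Otimes>\<^sub>M Y.P)"
  and space_limit_joining_Y [simp]: "space limit_joining_Y = space (Y.P \<Otimes>\<^sub>M Y.P)"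
  by (simp_all add: limit_joining_Y_def)

lemma prob_space_limit_joining_Y: "prob_space limit_joining_Y"
  unfolding limit_joining_Y_def
  by (rule prob_space.prob_space_distr[OF X.prob_space_limit_joining]) measurable

lemma tendsto_limit_joining_Y:
  assumes [measurable]: "G \<in> sets Y.P" "F \<in> sets Y.P"
  shows "(\<lambda>n. measure Y.P {y \<in> space Y.P. y \<in> G \<and> Y.W (t n) y \<in> F}) \<longlonglongrightarrow>
    measure limit_joining_Y (G \<times> F)"
proof -
  let ?G = "\<Psi> -` G \<inter> space X.P" and ?F = "\<Psi> -` F \<inter> space X.P"
  have "map_prod \<Psi> \<Psi> -` (G \<times> F) \<inter> space (X.P \<Otimes>\<^sub>M X.P) = ?G \<times> ?F"
    by (auto simp: space_pair_measure)
  then have lim: "measure limit_joining_Y (G \<times> F) = measure X.limit_joining (?G \<times> ?F)"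
    unfolding limit_joining_Y_def by (subst measure_distr) auto
  have "measure Y.P {y \<in> space Y.P. y \<in> G \<and> Y.W s y \<in> F} = measure X.P {x \<in> space X.P. x \<in> ?G \<and> X.W s x \<in> ?F}" for s
  proof -
    let ?A = "{x \<in> space X.P. x \<in> ?G \<and> X.W s x \<in> ?F}"
    have [measurable]: "?G \<in> sets X.P" "?F \<in> sets X.P" by measurable
    have "AE y in Y.P. \<Psi> (\<Phi> (Y.W s y)) = Y.W s y"
      by (rule AE_distrD[where M'=Y.P]) (measurable, simp only: Y.distr_W \<Psi>_\<Phi>)
    then have "AE y in Y.P. y \<in> \<Phi> -` ?A \<inter> space Y.P \<longleftrightarrow> y \<in> {y \<in> space Y.P. y \<in> G \<and> Y.W s y \<in> F}"
      using \<Psi>_\<Phi> intertwine[of s] AE_space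
      by eventually_elim
        (use measurable_space[OF meas_\<Phi>] measurable_space[OF Y.measurable_W[of s]] in auto)
    then have "measure Y.P {y \<in> space Y.P. y \<in> G \<and> Y.W s y \<in> F} = measure Y.P (\<Phi> -` ?A \<inter> space Y.P)"
      by (intro measure_eq_AE) auto
    also have "\<dots> = measure (distr Y.P X.P \<Phi>) ?A" by (rule measure_distr[symmetric]) measurable
    finally show ?thesis by (simp only: distr_\<Phi>)
  qed
  then show ?thesis
    unfolding lim using X.tendsto_limit_joining[of ?G ?F] by simp
qed

text \<open>
  The joint law of \<open>y\<close> and \<open>Y.W (t n) y\<close> is a product over the coordinates \<open>j\<close>, hence so is the limit.
\<close>

lemma limit_joining_Y_boxes:
  assumes G: "\<And>j. j \<in> I \<Longrightarrow> G j \<in> sets (N j)" and F: "\<And>j. j \<in> I \<Longrightarrow> F j \<in> sets (N j)"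
  shows "measure limit_joining_Y (Pi\<^sub>E I G \<times> Pi\<^sub>E I F) =
    (\<Prod>j\<in>I. measure limit_joining_Y (Y.cylinder j (G j) \<times> Y.cylinder j (F j)))"
proof (rule LIMSEQ_unique)
  have "Pi\<^sub>E I G \<in> sets Y.P" "Pi\<^sub>E I F \<in> sets Y.P"
    using G F Y.finite_index by (auto intro!: sets_PiM_I_finite)
  then show "(\<lambda>n. measure Y.P {y \<in> space Y.P. y \<in> Pi\<^sub>E I G \<and> Y.W (t n) y \<in> Pi\<^sub>E I F}) \<longlonglongrightarrow>
      measure limit_joining_Y (Pi\<^sub>E I G \<times> Pi\<^sub>E I F)"
    by (rule tendsto_limit_joining_Y)
  have "(\<lambda>n. measure (N j) {y \<in> space (N j). y \<in> G j \<and> S j (t n) y \<in> F j}) \<longlonglongrightarrow>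
      measure limit_joining_Y (Y.cylinder j (G j) \<times> Y.cylinder j (F j))" if j: "j \<in> I" for j
    using tendsto_limit_joining_Y[OF Y.sets_cylinder[OF j G[OF j]] Y.sets_cylinder[OF j F[OF j]]]
    by (simp add: Y.measure_cylinder_W[OF j G[OF j] F[OF j]])
  then show "(\<lambda>n. measure Y.P {y \<in> space Y.P. y \<in> Pi\<^sub>E I G \<and> Y.W (t n) y \<in> Pi\<^sub>E I F}) \<longlonglongrightarrow>
      (\<Prod>j\<in>I. measure limit_joining_Y (Y.cylinder j (G j) \<times> Y.cylinder j (F j)))"
    by (subst Y.measure_box_W) (use G F in \<open>auto intro!: tendsto_prod\<close>)
qed

text \<open>
  From two pairs, form the pair which takes the coordinates in \<open>B\<close> from the first and the other
  coordinates from the second. A joining that is a product over the coordinates is unchanged if this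
  is applied to two independent copies of it.
\<close>

definition exchange :: "'i set \<Rightarrow> (('i \<Rightarrow> 'b) \<times> ('i \<Rightarrow> 'b)) \<times> (('i \<Rightarrow> 'b) \<times> ('i \<Rightarrow> 'b)) \<Rightarrow> ('i \<Rightarrow> 'b) \<times> ('i \<Rightarrow> 'b)" where
  "exchange B r = (mix I B (fst (fst r)) (fst (snd r)), mix I B (snd (fst r)) (snd (snd r)))"

lemma measurable_exchange [measurable]:
  "exchange B \<in> measurable ((Y.P \<Otimes>\<^sub>M Y.P) \<Otimes>\<^sub>M (Y.P \<Otimes>\<^sub>M Y.P)) (Y.P \<Otimes>\<^sub>M Y.P)"
  unfolding exchange_def by measurable

lemma distr_exchange:
  "distr (limit_joining_Y \<Otimes>\<^sub>M limit_joining_Y) (Y.P \<Otimes>\<^sub>M Y.P) (exchange B) = limit_joining_Y"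
proof (rule measure_eqI_pair_boxes[OF Y.finite_index Y.finite_index])
  interpret R: prob_space limit_joining_Y by (rule prob_space_limit_joining_Y)
  interpret RR: pair_prob_space limit_joining_Y limit_joining_Y by unfold_locales
  show "finite_measure (distr (limit_joining_Y \<Otimes>\<^sub>M limit_joining_Y) (Y.P \<Otimes>\<^sub>M Y.P) (exchange B))"
    by (rule RR.P.finite_measure_distr) measurable
  fix G F assume G: "\<And>j. j \<in> I \<Longrightarrow> G j \<in> sets (N j)" and F: "\<And>j. j \<in> I \<Longrightarrow> F j \<in> sets (N j)"
  let ?c = "\<lambda>G F j. measure limit_joining_Y (Y.cylinder j (G j) \<times> Y.cylinder j (F j))"
  let ?l = "\<lambda>G j. if j \<in> B then G j else space (N j)" and ?r = "\<lambda>G j. if j \<in> B then space (N j) else G j"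
  have one: "measure limit_joining_Y (Y.cylinder j (space (N j)) \<times> Y.cylinder j (space (N j))) = 1" if "j \<in> I" for j
  proof -
    have "Y.cylinder j (space (N j)) = space Y.P"
      using that by (auto simp: Y.cylinder_def space_PiM PiE_iff extensional_def)
    then show ?thesis using R.prob_space by (simp add: space_pair_measure)
  qed
  have box [measurable]: "Pi\<^sub>E I H \<in> sets Y.P" if "\<And>j. j \<in> I \<Longrightarrow> H j \<in> sets (N j)" for H
    using that Y.finite_index by (auto intro!: sets_PiM_I_finite)
  have b: "Pi\<^sub>E I (?l G) \<in> sets Y.P" "Pi\<^sub>E I (?r G) \<in> sets Y.P" "Pi\<^sub>E I (?l F) \<in> sets Y.P"
    "Pi\<^sub>E I (?r F) \<in> sets Y.P" "Pi\<^sub>E I G \<in> sets Y.P" "Pi\<^sub>E I F \<in> sets Y.P"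
    by (rule box, use G F in auto)+
  have split: "y \<in> space Y.P \<and> u \<in> space Y.P \<and> mix I B y u \<in> Pi\<^sub>E I H \<longleftrightarrow> y \<in> Pi\<^sub>E I (?l H) \<and> u \<in> Pi\<^sub>E I (?r H)"
    if H: "\<forall>j\<in>I. H j \<in> sets (N j)" for H y u
  proof -
    have "y j \<in> ?l H j \<and> u j \<in> ?r H j \<longleftrightarrow> (if j \<in> B then y j else u j) \<in> H j \<and> y j \<in> space (N j) \<and> u j \<in> space (N j)"
      if "j \<in> I" for j
      using sets.sets_into_space[OF bspec[OF H that]] by auto
    then show ?thesis unfolding mix_in_PiE_iff space_PiM by (simp only: PiE_iff) blast
  qed
  have G': "\<forall>j\<in>I. G j \<in> sets (N j)" and F': "\<forall>j\<in>I. F j \<in> sets (N j)" using G F by auto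
  have eq: "exchange B -` (Pi\<^sub>E I G \<times> Pi\<^sub>E I F) \<inter> space (limit_joining_Y \<Otimes>\<^sub>M limit_joining_Y) =
      (Pi\<^sub>E I (?l G) \<times> Pi\<^sub>E I (?l F)) \<times> (Pi\<^sub>E I (?r G) \<times> Pi\<^sub>E I (?r F))"
  proof (rule set_eqI, clarify)
    fix y y' u u'
    show "((y, y'), (u, u')) \<in> exchange B -` (Pi\<^sub>E I G \<times> Pi\<^sub>E I F) \<inter> space (limit_joining_Y \<Otimes>\<^sub>M limit_joining_Y) \<longleftrightarrow>
        ((y, y'), (u, u')) \<in> (Pi\<^sub>E I (?l G) \<times> Pi\<^sub>E I (?l F)) \<times> (Pi\<^sub>E I (?r G) \<times> Pi\<^sub>E I (?r F))"
      using split[OF G', of y u] split[OF F', of y' u']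
      unfolding vimage_eq Int_iff space_pair_measure space_limit_joining_Y mem_Times_iff exchange_def fst_conv snd_conv
      by argo
  qed
  have "emeasure (distr (limit_joining_Y \<Otimes>\<^sub>M limit_joining_Y) (Y.P \<Otimes>\<^sub>M Y.P) (exchange B)) (Pi\<^sub>E I G \<times> Pi\<^sub>E I F) =
      emeasure (limit_joining_Y \<Otimes>\<^sub>M limit_joining_Y) ((Pi\<^sub>E I (?l G) \<times> Pi\<^sub>E I (?l F)) \<times> (Pi\<^sub>E I (?r G) \<times> Pi\<^sub>E I (?r F)))"
    unfolding eq[symmetric] using b(5,6) by (intro emeasure_distr) auto
  also have "\<dots> = emeasure limit_joining_Y (Pi\<^sub>E I (?l G) \<times> Pi\<^sub>E I (?l F)) * emeasure limit_joining_Y (Pi\<^sub>E I (?r G) \<times> Pi\<^sub>E I (?r F))"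
    using b by (intro R.emeasure_pair_measure_Times) auto
  also have "\<dots> = ennreal ((\<Prod>j\<in>I. ?c (?l G) (?l F) j) * (\<Prod>j\<in>I. ?c (?r G) (?r F) j))"
    unfolding R.emeasure_eq_measure
    by (subst (1 2) limit_joining_Y_boxes) (use G F in \<open>auto simp: ennreal_mult prod_nonneg\<close>)
  also have "(\<Prod>j\<in>I. ?c (?l G) (?l F) j) * (\<Prod>j\<in>I. ?c (?r G) (?r F) j) = (\<Prod>j\<in>I. ?c G F j)"
    unfolding prod.distrib[symmetric] by (intro prod.cong) (auto simp: one)
  also have "\<dots> = measure limit_joining_Y (Pi\<^sub>E I G \<times> Pi\<^sub>E I F)"
    by (rule limit_joining_Y_boxes[symmetric]) (use G F in auto)
  finally show "emeasure (distr (limit_joining_Y \<Otimes>\<^sub>M limit_joining_Y) (Y.P \<Otimes>\<^sub>M Y.P) (exchange B)) (Pi\<^sub>E I G \<times> Pi\<^sub>E I F) =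
      emeasure limit_joining_Y (Pi\<^sub>E I G \<times> Pi\<^sub>E I F)" by (simp only: R.emeasure_eq_measure)
qed simp_all

lemma distr_coupling_\<Psi>\<Psi>:
  assumes "A = I \<or> A = {}"
  shows "distr (coupling I M A) (Y.P \<Otimes>\<^sub>M Y.P) (map_prod \<Psi> \<Psi>) = coupling I N A"
  using assms
proof
  assume "A = I"
  have "distr (coupling I M I) (Y.P \<Otimes>\<^sub>M Y.P) (map_prod \<Psi> \<Psi>) = distr X.P (Y.P \<Otimes>\<^sub>M Y.P) (\<lambda>x. (\<Psi> x, \<Psi> x))"
    unfolding X.coupling_full by (subst distr_distr) (auto simp: comp_def)
  also have "\<dots> = distr (distr X.P Y.P \<Psi>) (Y.P \<Otimes>\<^sub>M Y.P) (\<lambda>y. (y, y))"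
    by (subst distr_distr) (auto simp: comp_def)
  finally show ?thesis by (simp only: \<open>A = I\<close> distr_\<Psi> Y.coupling_full)
next
  assume "A = {}"
  have "distr (X.P \<Otimes>\<^sub>M X.P) (Y.P \<Otimes>\<^sub>M Y.P) (\<lambda>(x, z). (\<Psi> x, \<Psi> z)) = distr X.P Y.P \<Psi> \<Otimes>\<^sub>M distr X.P Y.P \<Psi>"
    by (rule pair_measure_distr[symmetric])
      (simp_all only: meas_\<Psi> distr_\<Psi> prob_space_imp_sigma_finite[OF Y.prob_P])
  then show ?thesis by (simp only: \<open>A = {}\<close> X.coupling_empty Y.coupling_empty distr_\<Psi> map_prod_def)
qed

lemma AE_limit_joining_Y_imp:
  assumes A: "A = I \<or> A = {}" and Q: "{p \<in> space (Y.P \<Otimes>\<^sub>M Y.P). Q p} \<in> sets (Y.P \<Otimes>\<^sub>M Y.P)"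
    and ae: "AE p in limit_joining_Y. Q p"
  shows "AE p in coupling I N A. Q p"
proof -
  have m: "map_prod \<Psi> \<Psi> \<in> measurable X.limit_joining (Y.P \<Otimes>\<^sub>M Y.P)" by measurable
  have m': "map_prod \<Psi> \<Psi> \<in> measurable (coupling I M A) (Y.P \<Otimes>\<^sub>M Y.P)" by measurable
  have "{p \<in> space (X.P \<Otimes>\<^sub>M X.P). Q (map_prod \<Psi> \<Psi> p)} =
      map_prod \<Psi> \<Psi> -` {p \<in> space (Y.P \<Otimes>\<^sub>M Y.P). Q p} \<inter> space (X.P \<Otimes>\<^sub>M X.P)"
    using measurable_space[OF meas_\<Psi>\<Psi>] by blast
  also have "\<dots> \<in> sets (X.P \<Otimes>\<^sub>M X.P)" by (rule measurable_sets[OF meas_\<Psi>\<Psi> Q])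
  finally have Q': "{p \<in> space (X.P \<Otimes>\<^sub>M X.P). Q (map_prod \<Psi> \<Psi> p)} \<in> sets (X.P \<Otimes>\<^sub>M X.P)" .
  have "AE p in X.limit_joining. Q (map_prod \<Psi> \<Psi> p)"
    using ae unfolding limit_joining_Y_def by (rule AE_distrD[OF m])
  then have "AE p in coupling I M A. Q (map_prod \<Psi> \<Psi> p)"
    using A by (auto simp: X.AE_limit_joining_iff[OF Q'])
  then have "AE p in distr (coupling I M A) (Y.P \<Otimes>\<^sub>M Y.P) (map_prod \<Psi> \<Psi>). Q p"
    by (subst AE_distr_iff[OF m' Q])
  then show ?thesis by (simp only: distr_coupling_\<Psi>\<Psi>[OF A])
qed

text \<open>
  Each coupling on the side of \<open>N\<close> is absolutely continuous with respect to the limiting joining.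
  For the diagonal and the product measure this holds because it does on the side of \<open>M\<close>, where the
  limiting joining is a mixture with positive weights; the general case is obtained by exchanging
  coordinates between these two.
\<close>

lemma coupling_absolutely_continuous:
  assumes E [measurable]: "E \<in> sets (Y.P \<Otimes>\<^sub>M Y.P)" and ae: "AE p in limit_joining_Y. p \<notin> E"
  shows "AE p in coupling I N B. p \<notin> E"
proof -
  interpret R: prob_space limit_joining_Y by (rule prob_space_limit_joining_Y)
  interpret RR: pair_prob_space limit_joining_Y limit_joining_Y by unfold_locales
  interpret PP: pair_prob_space Y.P Y.P by (rule Y.pair_prob)
  have m: "exchange B \<in> measurable (limit_joining_Y \<Otimes>\<^sub>M limit_joining_Y) (Y.P \<Otimes>\<^sub>M Y.P)"
    by measurable
  have "AE r in limit_joining_Y \<Otimes>\<^sub>M limit_joining_Y. exchange B r \<notin> E"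
    by (rule AE_distrD[OF m]) (simp only: distr_exchange ae)
  then have 1: "AE p in limit_joining_Y. AE q in limit_joining_Y. exchange B (p, q) \<notin> E"
    by (rule RR.AE_pair)
  let ?E = "exchange B -` E \<inter> space ((Y.P \<Otimes>\<^sub>M Y.P) \<Otimes>\<^sub>M limit_joining_Y)"
  have s1: "?E \<in> sets ((Y.P \<Otimes>\<^sub>M Y.P) \<Otimes>\<^sub>M limit_joining_Y)" by measurable
  have "{p \<in> space (Y.P \<Otimes>\<^sub>M Y.P). AE q in limit_joining_Y. exchange B (p, q) \<notin> E} =
      {p \<in> space (Y.P \<Otimes>\<^sub>M Y.P). AE q in limit_joining_Y. (p, q) \<notin> ?E}"
    by (intro Collect_cong conj_cong refl AE_cong) (auto simp: space_pair_measure)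
  also have "\<dots> \<in> sets (Y.P \<Otimes>\<^sub>M Y.P)"
    by (rule sets_AE_section[OF R.sigma_finite_measure_axioms s1])
  finally have "AE p in coupling I N I. AE q in limit_joining_Y. exchange B (p, q) \<notin> E"
    using 1 by (intro AE_limit_joining_Y_imp) auto
  then have "AE p in coupling I N I. AE q in coupling I N {}. exchange B (p, q) \<notin> E"
    using AE_space
  proof eventually_elim
    case (elim p)
    have "{q \<in> space (Y.P \<Otimes>\<^sub>M Y.P). exchange B (p, q) \<notin> E} \<in> sets (Y.P \<Otimes>\<^sub>M Y.P)"
      using elim(2) by simp
    then show ?case using elim(1) by (intro AE_limit_joining_Y_imp) auto
  qed
  then have "AE y in Y.P. AE q in Y.P \<Otimes>\<^sub>M Y.P. exchange B ((y, y), q) \<notin> E"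
    unfolding Y.coupling_full Y.coupling_empty by (rule AE_distrD[rotated]) measurable
  then have 2: "AE y in Y.P. AE u in Y.P. AE u' in Y.P. (mix I B y u, mix I B (mix I B y u) u') \<notin> E"
  proof eventually_elim
    case (elim y)
    from PP.AE_pair[OF this] show ?case by (simp add: exchange_def mix_mix_left_mono)
  qed
  let ?F = "(\<lambda>(w, u). (w, mix I B w u)) -` E \<inter> space (Y.P \<Otimes>\<^sub>M Y.P)"
  have s2: "?F \<in> sets (Y.P \<Otimes>\<^sub>M Y.P)" by measurable
  have "{w \<in> space Y.P. AE u' in Y.P. (w, mix I B w u') \<notin> E} = {w \<in> space Y.P. AE u' in Y.P. (w, u') \<notin> ?F}"
    by (intro Collect_cong conj_cong refl AE_cong) (auto simp: space_pair_measure)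
  also have "\<dots> \<in> sets Y.P"
    by (rule sets_AE_section[OF prob_space_imp_sigma_finite[OF Y.prob_P] s2])
  finally have "AE w in Y.P. AE u' in Y.P. (w, mix I B w u') \<notin> E"
    by (rule Y.AE_mixD[OF 2])
  then show ?thesis by (subst Y.AE_coupling_iff) auto
qed

end

context product_isomorphism
begin

lemma AE_pair_marginals:
  assumes f: "distr K Y.P fst = Y.P" "distr K Y.P snd = Y.P" and K: "sets K = sets (Y.P \<Otimes>\<^sub>M Y.P)"
    and Q: "AE y in Y.P. Q y"
  shows "AE p in K. Q (fst p) \<and> Q (snd p)"
proof -
  have m: "fst \<in> measurable K Y.P" "snd \<in> measurable K Y.P"
    unfolding measurable_cong_sets[OF K refl] by measurable
  have "AE p in K. Q (fst p)" by (rule AE_distrD[OF m(1)]) (simp only: f Q)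
  moreover have "AE p in K. Q (snd p)" by (rule AE_distrD[OF m(2)]) (simp only: f Q)
  ultimately show ?thesis by eventually_elim simp
qed

text \<open>
  Transported by \<open>\<Phi>\<close>, the coupling over \<open>B\<close> is invariant and absolutely continuous with respect to
  the limiting joining. The set \<open>D\<close> where its density is positive is therefore an invariant event,
  hence null or conull for each of the (ergodic) couplings on the side of \<open>M\<close>: the transported
  coupling has the same null sets as the sum of those for which \<open>D\<close> is conull.
\<close>

lemma coupling_equivalent:
  obtains \<A> where "\<A> \<subseteq> Pow I" "\<A> \<noteq> {}"
    "\<And>Q. {p \<in> space (X.P \<Otimes>\<^sub>M X.P). Q p} \<in> sets (X.P \<Otimes>\<^sub>M X.P) \<Longrightarrow>
      (AE p in coupling I N B. Q (map_prod \<Phi> \<Phi> p)) \<longleftrightarrow> (\<forall>A\<in>\<A>. AE p in coupling I M A. Q p)"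
proof -
  let ?C = "coupling I N B" and ?L = X.limit_joining and ?XX = "X.P \<Otimes>\<^sub>M X.P"
  interpret L: prob_space ?L by (rule X.prob_space_limit_joining)
  interpret C: prob_space ?C by (rule Y.prob_space_coupling)
  have mC: "map_prod \<Phi> \<Phi> \<in> measurable ?C ?XX" by measurable
  have mL: "map_prod \<Psi> \<Psi> \<in> measurable ?L (Y.P \<Otimes>\<^sub>M Y.P)" by measurable
  define \<Theta> where "\<Theta> = distr ?C ?XX (map_prod \<Phi> \<Phi>)"
  have [simp, measurable_cong]: "sets \<Theta> = sets ?XX" by (simp add: \<Theta>_def)
  have \<Theta>_iff: "(AE p in \<Theta>. Q p) \<longleftrightarrow> (AE p in ?C. Q (map_prod \<Phi> \<Phi> p))"
    if "{p \<in> space ?XX. Q p} \<in> sets ?XX" for Q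
    unfolding \<Theta>_def by (rule AE_distr_iff[OF mC that])
  have ac: "absolutely_continuous ?L \<Theta>"
    unfolding absolutely_continuous_def
  proof
    fix E assume E: "E \<in> null_sets ?L"
    then have [measurable]: "E \<in> sets ?XX" by auto
    have "AE x in distr ?L X.P fst. \<Phi> (\<Psi> x) = x" "AE x in distr ?L X.P snd. \<Phi> (\<Psi> x) = x"
      by (simp_all only: X.distr_limit_joining \<Phi>_\<Psi>)
    then have "AE p in ?L. \<Phi> (\<Psi> (fst p)) = fst p" "AE p in ?L. \<Phi> (\<Psi> (snd p)) = snd p"
      by (auto dest!: AE_distrD[rotated])
    moreover have "AE p in ?L. p \<notin> E" using E by (rule AE_not_in)
    ultimately have "AE p in ?L. map_prod \<Psi> \<Psi> p \<notin> map_prod \<Phi> \<Phi> -` E \<inter> space (Y.P \<Otimes>\<^sub>M Y.P)"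
      by eventually_elim (auto simp: map_prod_def)
    then have "AE p in limit_joining_Y. p \<notin> map_prod \<Phi> \<Phi> -` E \<inter> space (Y.P \<Otimes>\<^sub>M Y.P)"
      unfolding limit_joining_Y_def by (subst AE_distr_iff[OF mL]) auto
    then have "AE p in ?C. p \<notin> map_prod \<Phi> \<Phi> -` E \<inter> space (Y.P \<Otimes>\<^sub>M Y.P)"
      by (rule coupling_absolutely_continuous[rotated]) measurable
    then have "AE p in ?C. map_prod \<Phi> \<Phi> p \<notin> E"
      using AE_space by eventually_elim auto
    then have "AE p in \<Theta>. p \<notin> E" by (subst \<Theta>_iff) auto
    then show "E \<in> null_sets \<Theta>" by (simp add: AE_iff_null_sets)
  qed
  obtain f where f [measurable]: "f \<in> borel_measurable ?L" and \<Theta>: "density ?L f = \<Theta>"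
    using L.Radon_Nikodym[OF ac] by auto
  define D where "D = {p \<in> space ?XX. 0 < f p}"
  have f' [measurable]: "f \<in> borel_measurable ?XX" using f by (simp cong: measurable_cong_sets)
  have D [measurable]: "D \<in> sets ?XX" unfolding D_def by measurable
  have \<Theta>_D: "(AE p in \<Theta>. Q p) \<longleftrightarrow> (\<forall>A\<in>Pow I. AE p in coupling I M A. p \<in> D \<longrightarrow> Q p)"
    if Q: "{p \<in> space ?XX. Q p} \<in> sets ?XX" for Q
  proof -
    have "(AE p in \<Theta>. Q p) \<longleftrightarrow> (AE p in ?L. 0 < f p \<longrightarrow> Q p)"
      unfolding \<Theta>[symmetric] by (rule AE_density[OF f])
    also have "\<dots> \<longleftrightarrow> (AE p in ?L. p \<in> D \<longrightarrow> Q p)"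
      by (rule AE_cong) (simp add: D_def)
    also have "\<dots> \<longleftrightarrow> (\<forall>A\<in>Pow I. AE p in coupling I M A. p \<in> D \<longrightarrow> Q p)"
    proof (rule X.AE_limit_joining_iff)
      have "{p \<in> space ?XX. p \<in> D \<longrightarrow> Q p} = (space ?XX - D) \<union> {p \<in> space ?XX. Q p}" by auto
      also have "\<dots> \<in> sets ?XX" using Q by measurable
      finally show "{p \<in> space ?XX. p \<in> D \<longrightarrow> Q p} \<in> sets ?XX" .
    qed
    finally show ?thesis .
  qed
  have inv: "AE p in coupling I M A. map_prod (X.W s) (X.W s) p \<in> D \<longleftrightarrow> p \<in> D" if A: "A \<in> Pow I" for A s
  proof -
    interpret A: prob_space "coupling I M A" by (rule X.prob_space_coupling)
    let ?W = "map_prod (X.W s) (X.W s)" and ?V = "map_prod (Y.W s) (Y.W s)"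
    have mW [measurable]: "?W \<in> measurable ?XX ?XX" unfolding map_prod_def by measurable
    have mV: "?V \<in> measurable ?C (Y.P \<Otimes>\<^sub>M Y.P)" unfolding map_prod_def by measurable
    have mWA: "?W \<in> measurable (coupling I M A) ?XX" by measurable
    have "AE p in \<Theta>. p \<in> D" by (subst \<Theta>_D) auto
    then have "AE q in ?C. map_prod \<Phi> \<Phi> q \<in> D" by (subst (asm) \<Theta>_iff) auto
    then have "AE q in distr ?C (Y.P \<Otimes>\<^sub>M Y.P) ?V. map_prod \<Phi> \<Phi> q \<in> D"
      by (simp only: Y.distr_coupling_W)
    then have "AE q in ?C. map_prod \<Phi> \<Phi> (?V q) \<in> D" by (rule AE_distrD[OF mV])
    moreover have "AE q in ?C. X.W s (\<Phi> (fst q)) = \<Phi> (Y.W s (fst q)) \<and> X.W s (\<Phi> (snd q)) = \<Phi> (Y.W s (snd q))"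
      by (rule AE_pair_marginals[OF Y.distr_coupling_fst Y.distr_coupling_snd _ intertwine]) simp
    ultimately have "AE q in ?C. ?W (map_prod \<Phi> \<Phi> q) \<in> D"
      by eventually_elim (auto simp: map_prod_def case_prod_beta)
    then have "AE p in \<Theta>. ?W p \<in> D" by (subst \<Theta>_iff) auto
    then have sub: "AE p in coupling I M A. p \<in> D \<longrightarrow> ?W p \<in> D"
      using A by (subst (asm) \<Theta>_D) auto
    \<comment> \<open>\<open>D\<close> is contained in its preimage, which has the same measure.\<close>
    let ?D = "?W -` D \<inter> space ?XX"
    have D': "?D \<in> sets ?XX" by measurable
    have "measure (coupling I M A) ?D = measure (distr (coupling I M A) ?XX ?W) D"
      using measure_distr[OF mWA D] by simp
    then have m: "measure (coupling I M A) ?D = measure (coupling I M A) D"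
      by (simp only: X.distr_coupling_W)
    have "measure (coupling I M A) (D \<inter> ?D) = measure (coupling I M A) D"
      using sub D D' sets.sets_into_space[OF D] by (intro measure_eq_AE) auto
    then have "measure (coupling I M A) (?D - D) = 0"
      using A.finite_measure_Diff'[of ?D D] D D' m by (simp add: Int_commute)
    then have "?D - D \<in> null_sets (coupling I M A)"
      using D D' by (auto simp: null_sets_def A.emeasure_eq_measure)
    then have "AE p in coupling I M A. p \<notin> ?D - D" by (rule AE_not_in)
    then show ?thesis using sub AE_space by eventually_elim auto
  qed
  define \<A> where "\<A> = {A \<in> Pow I. measure (coupling I M A) D = 1}"
  have main: "(AE p in ?C. Q (map_prod \<Phi> \<Phi> p)) \<longleftrightarrow> (\<forall>A\<in>\<A>. AE p in coupling I M A. Q p)"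
    if Q: "{p \<in> space ?XX. Q p} \<in> sets ?XX" for Q
  proof -
    have "(AE p in coupling I M A. p \<in> D \<longrightarrow> Q p) \<longleftrightarrow> (A \<in> \<A> \<longrightarrow> (AE p in coupling I M A. Q p))"
      if A: "A \<in> Pow I" for A
    proof (cases "A \<in> \<A>")
      case True
      then have "AE p in coupling I M A. p \<in> D"
        by (simp add: \<A>_def prob_space.prob_eq_1[OF X.prob_space_coupling])
      then show ?thesis using True by (auto elim: eventually_elim2)
    next
      case False
      have "measure (coupling I M A) D = 0"
        using X.ergodic_coupling[OF D inv[OF A]] False A by (auto simp: \<A>_def)
      then have "D \<in> null_sets (coupling I M A)"
        by (simp add: null_sets_def finite_measure.emeasure_eq_measure[OF prob_space.finite_measure[OF X.prob_space_coupling]])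
      then have "AE p in coupling I M A. p \<notin> D" by (rule AE_not_in)
      then have "AE p in coupling I M A. p \<in> D \<longrightarrow> Q p" by eventually_elim simp
      then show ?thesis using False by simp
    qed
    then have "(\<forall>A\<in>Pow I. AE p in coupling I M A. p \<in> D \<longrightarrow> Q p) \<longleftrightarrow> (\<forall>A\<in>\<A>. AE p in coupling I M A. Q p)"
      by (auto simp: \<A>_def)
    then show ?thesis using \<Theta>_iff[OF Q] \<Theta>_D[OF Q] by simp
  qed
  have "\<A> \<subseteq> Pow I" by (auto simp: \<A>_def)
  \<comment> \<open>If \<open>\<A>\<close> were empty, the coupling over \<open>B\<close>, a probability, would vanish.\<close>
  moreover have "\<A> \<noteq> {}"
    using main[of "\<lambda>_. False"] by auto
  ultimately show ?thesis using main by (rule that)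
qed

text \<open>
  Being stable under intersections, dependence on each member of a family of coordinate sets amounts
  to dependence on its intersection.
\<close>

lemma depends_on_transport:
  "\<exists>A. A \<subseteq> I \<and> (\<forall>G\<in>sets X.P. Y.depends_on B (\<Phi> -` G \<inter> space Y.P) \<longleftrightarrow> X.depends_on A G)"
proof -
  obtain \<A> where \<A>: "\<A> \<subseteq> Pow I" "\<A> \<noteq> {}" and
    eq: "\<And>Q. {p \<in> space (X.P \<Otimes>\<^sub>M X.P). Q p} \<in> sets (X.P \<Otimes>\<^sub>M X.P) \<Longrightarrow>
      (AE p in coupling I N B. Q (map_prod \<Phi> \<Phi> p)) \<longleftrightarrow> (\<forall>A\<in>\<A>. AE p in coupling I M A. Q p)"
    by (rule coupling_equivalent[of B]) blast
  have fin: "finite \<A>" using \<A>(1) X.finite_index by (auto intro: finite_subset)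
  have "Y.depends_on B (\<Phi> -` G \<inter> space Y.P) \<longleftrightarrow> X.depends_on (\<Inter>\<A>) G" if G [measurable]: "G \<in> sets X.P" for G
  proof -
    have "Y.depends_on B (\<Phi> -` G \<inter> space Y.P) \<longleftrightarrow>
        (AE p in coupling I N B. fst (map_prod \<Phi> \<Phi> p) \<in> G \<longleftrightarrow> snd (map_prod \<Phi> \<Phi> p) \<in> G)"
      unfolding Y.depends_on_def
      by (rule AE_cong) (auto simp: space_pair_measure)
    also have "\<dots> \<longleftrightarrow> (\<forall>A\<in>\<A>. X.depends_on A G)"
      unfolding X.depends_on_def by (rule eq) measurable
    also have "\<dots> \<longleftrightarrow> X.depends_on (\<Inter>\<A>) G"
      using X.depends_on_INT[OF fin \<A>(2) G] X.depends_on_mono[OF G] by (blast intro: Inter_lower)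
    finally show ?thesis .
  qed
  moreover have "\<Inter>\<A> \<subseteq> I" using \<A> by blast
  ultimately show ?thesis by blast
qed

lemma depends_on_\<Psi>:
  assumes [measurable]: "H \<in> sets Y.P"
  shows "Y.depends_on B (\<Phi> -` (\<Psi> -` H \<inter> space X.P) \<inter> space Y.P) \<longleftrightarrow> Y.depends_on B H"
proof -
  have "AE p in coupling I N B. \<Psi> (\<Phi> (fst p)) = fst p \<and> \<Psi> (\<Phi> (snd p)) = snd p"
    by (rule AE_pair_marginals[OF Y.distr_coupling_fst Y.distr_coupling_snd _ \<Psi>_\<Phi>]) simp
  with AE_space have "AE p in coupling I N B.
      (fst p \<in> \<Phi> -` (\<Psi> -` H \<inter> space X.P) \<inter> space Y.P \<longleftrightarrow> snd p \<in> \<Phi> -` (\<Psi> -` H \<inter> space X.P) \<inter> space Y.P) \<longleftrightarrow>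
      (fst p \<in> H \<longleftrightarrow> snd p \<in> H)"
    by eventually_elim (use measurable_space[OF meas_\<Phi>] in \<open>auto simp: space_pair_measure\<close>)
  then show ?thesis unfolding Y.depends_on_def by (auto elim!: eventually_elim2)
qed

end

section \<open>Matching the coordinates\<close>

text \<open>
  A strictly monotone map of the subsets of a finite set into themselves preserves cardinalities: a
  maximal chain is mapped to a chain of the same length.
\<close>

lemma strictly_monotone_card_singleton:
  assumes I: "finite I" and \<gamma>: "\<And>B. B \<subseteq> I \<Longrightarrow> \<gamma> B \<subseteq> I"
    and strict: "\<And>B B'. B \<subset> B' \<Longrightarrow> B' \<subseteq> I \<Longrightarrow> \<gamma> B \<subset> \<gamma> B'" and j: "j \<in> I"
  shows "card (\<gamma> {j}) = 1"
proof -
  have fin: "finite (\<gamma> B)" if "B \<subseteq> I" for B using \<gamma>[OF that] I by (rule finite_subset)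
  have "card (\<gamma> {}) < card (\<gamma> {j})"
    using strict[of "{}" "{j}"] j fin[of "{j}"] by (intro psubset_card_mono) auto
  moreover have up: "card (\<gamma> (I - C)) + card C \<le> card I" if "finite C" "C \<subseteq> I" for C
    using that
  proof (induction C)
    case empty
    then show ?case using \<gamma>[of I] I by (simp add: card_mono)
  next
    case (insert x C)
    then have "card (\<gamma> (I - insert x C)) < card (\<gamma> (I - C))"
      by (intro psubset_card_mono strict fin) auto
    with insert show ?case by simp
  qed
  have "card (\<gamma> {j}) + (card I - 1) \<le> card I"
    using up[of "I - {j}"] I j by (simp add: Diff_Diff_Int Int_absorb1)
  moreover have "0 < card I" using I j by (auto simp: card_gt_0_iff)
  ultimately show ?thesis by linarith
qed

context product_isomorphism
begin

text \<open>
  A nontrivial event of a single coordinate depends on a set of coordinates iff that coordinate is in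
  the set. Such events on the side of \<open>M\<close> show that the correspondence of coordinate sets is monotone,
  those on the side of \<open>N\<close> that it separates distinct sets.
\<close>

lemma coordinates_match:
  assumes M: "\<And>i. i \<in> I \<Longrightarrow> \<exists>U\<in>sets (M i). measure (M i) U \<noteq> 0 \<and> measure (M i) U \<noteq> 1"
    and N: "\<And>i. i \<in> I \<Longrightarrow> \<exists>U\<in>sets (N i). measure (N i) U \<noteq> 0 \<and> measure (N i) U \<noteq> 1"
  obtains \<tau> where "bij_betw \<tau> I I"
    "\<And>j G. j \<in> I \<Longrightarrow> G \<in> sets X.P \<Longrightarrow>
      Y.depends_on {j} (\<Phi> -` G \<inter> space Y.P) \<longleftrightarrow> X.depends_on {\<tau> j} G"
proof -
  obtain \<gamma> where \<gamma>_sub: "\<And>B. \<gamma> B \<subseteq> I" and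
    \<gamma>: "\<And>B G. G \<in> sets X.P \<Longrightarrow> Y.depends_on B (\<Phi> -` G \<inter> space Y.P) \<longleftrightarrow> X.depends_on (\<gamma> B) G"
    using depends_on_transport by metis
  have \<gamma>': "X.depends_on (\<gamma> B) (\<Psi> -` H \<inter> space X.P) \<longleftrightarrow> Y.depends_on B H" if H: "H \<in> sets Y.P" for B H
    using \<gamma>[OF measurable_sets[OF meas_\<Psi> H], of B] depends_on_\<Psi>[OF H, of B] by simp
  have mono: "\<gamma> B \<subseteq> \<gamma> B'" if "B \<subseteq> B'" for B B'
  proof
    fix i assume i: "i \<in> \<gamma> B"
    then have iI: "i \<in> I" using \<gamma>_sub by blast
    obtain U where U: "U \<in> sets (M i)" "measure (M i) U \<noteq> 0" "measure (M i) U \<noteq> 1" using M[OF iI] by blast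
    let ?G = "X.cylinder i U"
    have G: "?G \<in> sets X.P" using iI U(1) by (rule X.sets_cylinder)
    have "Y.depends_on B (\<Phi> -` ?G \<inter> space Y.P)"
      using X.depends_on_cylinder[OF iI U(1) i] \<gamma>[OF G] by simp
    then have "Y.depends_on B' (\<Phi> -` ?G \<inter> space Y.P)"
      by (rule Y.depends_on_mono[OF measurable_sets[OF meas_\<Phi> G] _ that])
    then have "X.depends_on (\<gamma> B') ?G" using \<gamma>[OF G] by simp
    then show "i \<in> \<gamma> B'" using X.not_depends_on_cylinder[OF iI U] by blast
  qed
  have sep: "\<gamma> B \<noteq> \<gamma> B'" if j: "j \<in> I" "j \<in> B'" "j \<notin> B" for B B' j
  proof -
    obtain U where U: "U \<in> sets (N j)" "measure (N j) U \<noteq> 0" "measure (N j) U \<noteq> 1" using N[OF j(1)] by blast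
    have "Y.depends_on B' (Y.cylinder j U)" "\<not> Y.depends_on B (Y.cylinder j U)"
      using Y.depends_on_cylinder[OF j(1) U(1) j(2)] Y.not_depends_on_cylinder[OF j(1) U j(3)] by auto
    then show ?thesis using \<gamma>'[OF Y.sets_cylinder[OF j(1) U(1)]] by metis
  qed
  have strict: "\<gamma> B \<subset> \<gamma> B'" if B: "B \<subset> B'" "B' \<subseteq> I" for B B'
  proof -
    from B obtain j where "j \<in> I" "j \<in> B'" "j \<notin> B" by blast
    from sep[OF this] mono[of B B'] B(1) show ?thesis by blast
  qed
  have "\<exists>i. \<gamma> {j} = {i}" if "j \<in> I" for j
    using strictly_monotone_card_singleton[OF X.finite_index \<gamma>_sub strict that]
    by (simp add: card_1_singleton_iff)
  then obtain \<tau> where \<tau>: "\<And>j. j \<in> I \<Longrightarrow> \<gamma> {j} = {\<tau> j}" by metis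
  have inj: "inj_on \<tau> I"
  proof (rule inj_onI, rule ccontr)
    fix j k assume "j \<in> I" "k \<in> I" "\<tau> j = \<tau> k" "j \<noteq> k"
    then show False using sep[of j "{j}" "{k}"] \<tau> by simp
  qed
  have "\<tau> j \<in> I" if "j \<in> I" for j using \<tau>[OF that] \<gamma>_sub[of "{j}"] by simp
  then have "\<tau> ` I \<subseteq> I" by blast
  then have "bij_betw \<tau> I I"
    using inj endo_inj_surj[OF X.finite_index _ inj] unfolding bij_betw_def by blast
  then show ?thesis
    by (rule that) (simp add: \<gamma> \<tau>)
qed

end

section \<open>Isomorphism of matched coordinates\<close>

lemma sets_eq_separated:
  assumes "separates \<U> N" and f: "f \<in> measurable M N" "g \<in> measurable M N"
  shows "{x \<in> space M. f x = g x} \<in> sets M"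
proof -
  have \<U>: "countable \<U>" "\<And>U. U \<in> \<U> \<Longrightarrow> U \<in> sets N"
    "\<And>x y. x \<in> space N \<Longrightarrow> y \<in> space N \<Longrightarrow> (\<forall>U\<in>\<U>. x \<in> U \<longleftrightarrow> y \<in> U) \<Longrightarrow> x = y"
    using assms(1) by (auto simp: separates_def)
  have "f x = g x \<longleftrightarrow> (\<forall>U\<in>\<U>. f x \<in> U \<longleftrightarrow> g x \<in> U)" if "x \<in> space M" for x
    using \<U>(3)[of "f x" "g x"] measurable_space[OF f(1) that] measurable_space[OF f(2) that] by metis
  then have "{x \<in> space M. f x = g x} = {x \<in> space M. \<forall>U\<in>\<U>. f x \<in> U \<longleftrightarrow> g x \<in> U}"
    by (intro Collect_cong conj_cong refl)
  also have "\<dots> \<in> sets M"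
  proof (rule sets.sets_Collect_countable_All'[OF _ \<U>(1)])
    fix U assume "U \<in> \<U>"
    then have [measurable]: "U \<in> sets N" by (rule \<U>(2))
    note f [measurable]
    show "{x \<in> space M. f x \<in> U \<longleftrightarrow> g x \<in> U} \<in> sets M" by measurable
  qed
  finally show ?thesis .
qed

lemma L2_comp:
  assumes f: "f \<in> L2 M" and \<Phi>: "\<Phi> \<in> measurable N M" "distr N M \<Phi> = M"
  shows "(\<lambda>y. f (\<Phi> y)) \<in> L2 N"
proof -
  from f have m: "f \<in> borel_measurable M" and i: "integrable M (\<lambda>x. (norm (f x))\<^sup>2)" by (auto simp: L2_def)
  have "integrable (distr N M \<Phi>) (\<lambda>x. (norm (f x))\<^sup>2)" using i by (simp only: \<Phi>(2))
  then have "integrable N (\<lambda>y. (norm (f (\<Phi> y)))\<^sup>2)"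
    using \<Phi>(1) m by (subst (asm) integrable_distr_eq) auto
  then show ?thesis using measurable_compose[OF \<Phi>(1) m] by (simp add: L2_def)
qed

context finite_product_prob_space
begin

lemma distr_component: "i \<in> I \<Longrightarrow> distr P (M i) (\<lambda>x. x i) = M i"
  by (rule distr_PiM_component) (rule prob_space)

lemma AE_component_iff:
  assumes i: "i \<in> I" and Q: "{y \<in> space (M i). Q y} \<in> sets (M i)"
  shows "(AE y in M i. Q y) \<longleftrightarrow> (AE x in P. Q (x i))"
proof -
  have "(\<lambda>x. x i) \<in> measurable P (M i)" using i by (rule measurable_component_singleton)
  from AE_distr_iff[OF this Q] have "(AE y in distr P (M i) (\<lambda>x. x i). Q y) \<longleftrightarrow> (AE x in P. Q (x i))" .
  then show ?thesis by (simp only: distr_component[OF i])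
qed

end

context product_isomorphism
begin

text \<open>
  If the coordinate \<open>i\<close> of \<open>X\<close> corresponds to the coordinate \<open>j\<close> of \<open>Y\<close>, then \<open>\<Phi>\<close> and \<open>\<Psi>\<close> act between
  these coordinates through mutually inverse maps.
\<close>

lemma restricts_to_isomorphism:
  assumes i: "i \<in> I" and j: "j \<in> I"
    and \<U>: "separates \<U> (M i)" and \<V>: "separates \<V> (N j)"
    and match: "\<And>G. G \<in> sets X.P \<Longrightarrow>
      Y.depends_on {j} (\<Phi> -` G \<inter> space Y.P) \<longleftrightarrow> X.depends_on {i} G"
  shows "restricts_to_isomorphism I N S M T \<Phi> i j"
proof -
  have [measurable]: "(\<lambda>x. x i) \<in> measurable X.P (M i)" "(\<lambda>y. y j) \<in> measurable Y.P (N j)"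
    using i j by (auto intro: measurable_component_singleton)
  have \<Phi>i: "(\<lambda>y. \<Phi> y i) \<in> measurable Y.P (M i)" and \<Psi>j: "(\<lambda>x. \<Psi> x j) \<in> measurable X.P (N j)"
    by (rule measurable_compose[OF meas_\<Phi>] measurable_compose[OF meas_\<Psi>], measurable)+
  obtain \<phi> where \<phi> [measurable]: "\<phi> \<in> measurable (N j) (M i)" and \<Phi>_\<phi>: "AE y in Y.P. \<Phi> y i = \<phi> (y j)"
  proof (rule Y.factors_through_coordinate[OF j \<Phi>i \<U>])
    fix U assume "U \<in> \<U>"
    then have U: "U \<in> sets (M i)" using \<U> by (auto simp: separates_def)
    have "(\<lambda>y. \<Phi> y i) -` U \<inter> space Y.P = \<Phi> -` X.cylinder i U \<inter> space Y.P"
      using measurable_space[OF meas_\<Phi>] by (auto simp: X.cylinder_def)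
    then show "Y.depends_on {j} ((\<lambda>y. \<Phi> y i) -` U \<inter> space Y.P)"
      using match[OF X.sets_cylinder[OF i U]] X.depends_on_cylinder[OF i U, of "{i}"] by simp
  qed blast
  obtain \<psi> where \<psi> [measurable]: "\<psi> \<in> measurable (M i) (N j)" and \<Psi>_\<psi>: "AE x in X.P. \<Psi> x j = \<psi> (x i)"
  proof (rule X.factors_through_coordinate[OF i \<Psi>j \<V>])
    fix V assume "V \<in> \<V>"
    then have V: "V \<in> sets (N j)" using \<V> by (auto simp: separates_def)
    have "(\<lambda>x. \<Psi> x j) -` V \<inter> space X.P = \<Psi> -` Y.cylinder j V \<inter> space X.P"
      using measurable_space[OF meas_\<Psi>] by (auto simp: Y.cylinder_def)
    then show "X.depends_on {i} ((\<lambda>x. \<Psi> x j) -` V \<inter> space X.P)"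
      using match[OF measurable_sets[OF meas_\<Psi> Y.sets_cylinder[OF j V]]]
        depends_on_\<Psi>[OF Y.sets_cylinder[OF j V]] Y.depends_on_cylinder[OF j V, of "{j}"] by simp
  qed blast
  have pull_\<Phi>: "AE y in Y.P. Q (\<Phi> y)" if "AE x in X.P. Q x" for Q
    by (rule AE_distrD[OF meas_\<Phi>]) (simp only: distr_\<Phi> that)
  have pull_\<Psi>: "AE x in X.P. Q (\<Psi> x)" if "AE y in Y.P. Q y" for Q
    by (rule AE_distrD[OF meas_\<Psi>]) (simp only: distr_\<Psi> that)
  have \<psi>\<phi>: "AE y in Y.P. \<psi> (\<phi> (y j)) = y j"
    using pull_\<Phi>[OF \<Psi>_\<psi>] \<Phi>_\<phi> \<Psi>_\<Phi> by eventually_elim simp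
  have \<phi>\<psi>: "AE x in X.P. \<phi> (\<psi> (x i)) = x i"
    using pull_\<Psi>[OF \<Phi>_\<phi>] \<Psi>_\<psi> \<Phi>_\<Psi> by eventually_elim simp
  have distr_\<phi>: "distr (N j) (M i) \<phi> = M i"
  proof -
    have "distr (N j) (M i) \<phi> = distr (distr Y.P (N j) (\<lambda>y. y j)) (M i) \<phi>"
      by (simp only: Y.distr_component[OF j])
    also have "\<dots> = distr Y.P (M i) (\<lambda>y. \<phi> (y j))" by (subst distr_distr) (auto simp: comp_def)
    also have "\<dots> = distr Y.P (M i) (\<lambda>y. \<Phi> y i)"
      using \<Phi>_\<phi> \<Phi>i by (intro distr_cong_AE) (auto elim: eventually_mono)
    also have "\<dots> = distr (distr Y.P X.P \<Phi>) (M i) (\<lambda>x. x i)" by (subst distr_distr) (auto simp: comp_def)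
    finally show ?thesis by (simp only: distr_\<Phi> X.distr_component[OF i])
  qed
  have distr_\<psi>: "distr (M i) (N j) \<psi> = N j"
  proof -
    have "distr (M i) (N j) \<psi> = distr (distr X.P (M i) (\<lambda>x. x i)) (N j) \<psi>"
      by (simp only: X.distr_component[OF i])
    also have "\<dots> = distr X.P (N j) (\<lambda>x. \<psi> (x i))" by (subst distr_distr) (auto simp: comp_def)
    also have "\<dots> = distr X.P (N j) (\<lambda>x. \<Psi> x j)"
      using \<Psi>_\<psi> \<Psi>j by (intro distr_cong_AE) (auto elim: eventually_mono)
    also have "\<dots> = distr (distr X.P Y.P \<Psi>) (N j) (\<lambda>y. y j)" by (subst distr_distr) (auto simp: comp_def)
    finally show ?thesis by (simp only: distr_\<Psi> Y.distr_component[OF j])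
  qed
  have iso: "flow_isomorphism (N j) (S j) (M i) (T i) \<phi>"
    unfolding flow_isomorphism_def
  proof (intro conjI bexI[of _ \<psi>] allI)
    show "AE y in N j. \<psi> (\<phi> y) = y"
      by (subst Y.AE_component_iff[OF j sets_eq_separated[OF \<V>]]) (use \<psi>\<phi> in auto)
    show "AE x in M i. \<phi> (\<psi> x) = x"
      by (subst X.AE_component_iff[OF i sets_eq_separated[OF \<U>]]) (use \<phi>\<psi> in auto)
    fix s
    have "AE y in Y.P. \<Phi> (Y.W s y) i = \<phi> (Y.W s y j)"
      by (rule AE_distrD[OF Y.measurable_W[of s]]) (simp only: Y.distr_W \<Phi>_\<phi>)
    then have "AE y in Y.P. T i s (\<phi> (y j)) = \<phi> (S j s (y j))"
      using \<Phi>_\<phi> intertwine[of s]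
    proof eventually_elim
      case (elim y)
      have "T i s (\<phi> (y j)) = X.W s (\<Phi> y) i" using elim(2) i by (simp add: product_flow_def)
      also have "\<dots> = \<phi> (Y.W s y j)" using elim(1,3) by simp
      finally show ?case using j by (simp add: product_flow_def)
    qed
    then show "AE y in N j. T i s (\<phi> y) = \<phi> (S j s y)"
      by (subst Y.AE_component_iff[OF j sets_eq_separated[OF \<U>]]) auto
  qed (simp_all add: distr_\<phi>)
  have onto: "maps_onto_ae Y.P (koopman \<Phi>) (L2_coord I M i) (L2_coord I N j)"
    unfolding maps_onto_ae_def
  proof (intro conjI ballI)
    fix f assume "f \<in> L2_coord I M i"
    then obtain h where f: "f \<in> L2 X.P" and h: "h \<in> L2 (M i)" and fh: "AE x in X.P. f x = h (x i)"
      by (auto simp: L2_coord_def)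
    have "koopman \<Phi> f \<in> L2 Y.P"
      using L2_comp[OF f meas_\<Phi> distr_\<Phi>] by (simp add: koopman_def comp_def)
    moreover have "(\<lambda>y. h (\<phi> y)) \<in> L2 (N j)" by (rule L2_comp[OF h \<phi> distr_\<phi>])
    moreover have "AE y in Y.P. koopman \<Phi> f y = h (\<phi> (y j))"
      using pull_\<Phi>[OF fh] \<Phi>_\<phi> by eventually_elim (simp add: koopman_def)
    ultimately show "koopman \<Phi> f \<in> L2_coord I N j" by (auto simp: L2_coord_def)
  next
    fix g assume "g \<in> L2_coord I N j"
    then obtain k where k: "k \<in> L2 (N j)" and gk: "AE y in Y.P. g y = k (y j)"
      by (auto simp: L2_coord_def)
    let ?f = "\<lambda>x. k (\<psi> (x i))"
    have k\<psi>: "(\<lambda>x. k (\<psi> x)) \<in> L2 (M i)" by (rule L2_comp[OF k \<psi> distr_\<psi>])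
    have "?f \<in> L2 X.P"
      by (rule L2_comp[OF k\<psi> _ X.distr_component[OF i]]) measurable
    then have "?f \<in> L2_coord I M i" using k\<psi> by (auto simp: L2_coord_def)
    moreover have "AE y in Y.P. koopman \<Phi> ?f y = g y"
      using gk \<psi>\<phi> \<Phi>_\<phi> by eventually_elim (simp add: koopman_def)
    ultimately show "\<exists>f\<in>L2_coord I M i. AE y in Y.P. koopman \<Phi> f y = g y" by blast
  qed
  have "AE y in Y.P. koopman \<Phi> (\<lambda>x. h (x i)) y = koopman \<phi> h (y j)" for h :: "'a \<Rightarrow> complex"
    using \<Phi>_\<phi> by eventually_elim (simp add: koopman_def)
  with iso onto show ?thesis unfolding restricts_to_isomorphism_def by blast
qed

lemma restricts_to_isomorphism_permutation:
  assumes M: "\<And>i. i \<in> I \<Longrightarrow> \<exists>U\<in>sets (M i). measure (M i) U \<noteq> 0 \<and> measure (M i) U \<noteq> 1"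
    and N: "\<And>i. i \<in> I \<Longrightarrow> \<exists>U\<in>sets (N i). measure (N i) U \<noteq> 0 \<and> measure (N i) U \<noteq> 1"
    and sep: "\<And>i. i \<in> I \<Longrightarrow> \<exists>\<U>. separates \<U> (M i)" "\<And>i. i \<in> I \<Longrightarrow> \<exists>\<V>. separates \<V> (N i)"
  shows "\<exists>\<sigma>. \<sigma> permutes I \<and> (\<forall>i\<in>I. restricts_to_isomorphism I N S M T \<Phi> i (\<sigma> i))"
proof -
  obtain \<tau> where \<tau>: "bij_betw \<tau> I I" and
    match: "\<And>j G. j \<in> I \<Longrightarrow> G \<in> sets X.P \<Longrightarrow>
      Y.depends_on {j} (\<Phi> -` G \<inter> space Y.P) \<longleftrightarrow> X.depends_on {\<tau> j} G"
    using coordinates_match[OF M N] by blast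
  define \<sigma> where "\<sigma> = (\<lambda>i. if i \<in> I then inv_into I \<tau> i else i)"
  have "bij_betw \<sigma> I I"
    using bij_betw_inv_into[OF \<tau>] by (rule bij_betw_cong[THEN iffD1, rotated]) (simp add: \<sigma>_def)
  then have "\<sigma> permutes I" by (rule bij_imp_permutes) (simp add: \<sigma>_def)
  moreover have "restricts_to_isomorphism I N S M T \<Phi> i (\<sigma> i)" if i: "i \<in> I" for i
  proof -
    have s: "\<sigma> i \<in> I" "\<tau> (\<sigma> i) = i"
      using i \<tau> \<open>bij_betw \<sigma> I I\<close> by (auto simp: \<sigma>_def bij_betw_def f_inv_into_f inv_into_into)
    obtain \<U> \<V> where "separates \<U> (M i)" "separates \<V> (N (\<sigma> i))" using sep i s(1) by blast
    then show ?thesis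
      using match[OF s(1)] s by (intro restricts_to_isomorphism[OF i s(1)]) auto
  qed
  ultimately show ?thesis by blast
qed

end

section \<open>Alpha-weakly mixing flows\<close>

lemma (in flow) alpha_weakly_mixing_events:
  assumes mix: "alpha_weakly_mixing_along M T \<alpha> t" and G: "G \<in> sets M" and F: "F \<in> sets M"
  shows "(\<lambda>n. measure M {x \<in> space M. x \<in> G \<and> T (t n) x \<in> F}) \<longlonglongrightarrow>
    (1 - \<alpha>) * measure M (G \<inter> F) + \<alpha> * (measure M G * measure M F)"
proof -
  let ?i = "\<lambda>A. \<lambda>x. complex_of_real (indicator A x)"
  note measurable_T [measurable] G [measurable] F [measurable]
  have L2: "?i A \<in> L2 M" if [measurable]: "A \<in> sets M" for A
  proof -
    have "(\<lambda>x. (norm (?i A x))\<^sup>2) = indicator A" by (auto simp: indicator_def)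
    then show ?thesis by (simp add: L2_def integrable_real_indicator emeasure_eq_measure)
  qed
  have int: "(\<integral>x. ?i A x \<partial>M) = of_real (measure M A)" if "A \<in> sets M" for A
    using that by simp
  have lhs: "L2_inner M (koopman (T s) (?i F)) (?i G) = of_real (measure M {x \<in> space M. x \<in> G \<and> T s x \<in> F})" for s
  proof -
    have "L2_inner M (koopman (T s) (?i F)) (?i G) = (\<integral>x. ?i {x \<in> space M. x \<in> G \<and> T s x \<in> F} x \<partial>M)"
      unfolding L2_inner_def koopman_def
      by (intro Bochner_Integration.integral_cong refl) (auto simp: indicator_def)
    then show ?thesis by (simp only: int) (subst int, measurable)
  qed
  have rhs: "L2_inner M (\<lambda>x. of_real \<alpha> * mean_op M (?i F) x + of_real (1 - \<alpha>) * ?i F x) (?i G) =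
      of_real ((1 - \<alpha>) * measure M (G \<inter> F) + \<alpha> * (measure M G * measure M F))"
  proof -
    have I: "integrable M (?i A)" if "A \<in> sets M" for A
      using that by (intro integrable_of_real) (simp add: integrable_real_indicator emeasure_eq_measure)
    have "L2_inner M (\<lambda>x. of_real \<alpha> * mean_op M (?i F) x + of_real (1 - \<alpha>) * ?i F x) (?i G) =
        (\<integral>x. of_real (\<alpha> * measure M F) * ?i G x + of_real (1 - \<alpha>) * ?i (G \<inter> F) x \<partial>M)"
      unfolding L2_inner_def mean_op_def int[OF F]
      by (intro Bochner_Integration.integral_cong refl) (auto simp: indicator_def)
    also have "\<dots> = of_real (\<alpha> * measure M F) * (\<integral>x. ?i G x \<partial>M) + of_real (1 - \<alpha>) * (\<integral>x. ?i (G \<inter> F) x \<partial>M)"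
      using I[OF G] I[of "G \<inter> F"] by (subst Bochner_Integration.integral_add) auto
    also have "\<dots> = of_real ((1 - \<alpha>) * measure M (G \<inter> F) + \<alpha> * (measure M G * measure M F))"
      using G F by (subst (1 2) int) (auto simp: algebra_simps)
    finally show ?thesis .
  qed
  have "(\<lambda>n. L2_inner M (koopman (T (t n)) (?i F)) (?i G)) \<longlonglongrightarrow>
      L2_inner M (\<lambda>x. of_real \<alpha> * mean_op M (?i F) x + of_real (1 - \<alpha>) * ?i F x) (?i G)"
    using mix L2[OF F] L2[OF G] unfolding alpha_weakly_mixing_along_def wot_tendsto_def by blast
  then show ?thesis unfolding lhs rhs tendsto_of_real_iff .
qed

lemma product_flow_isomorphism_restricts:
  fixes I :: "'i set"
  assumes I: "finite I"
    and X: "\<And>i. flow (X i) (T i)" and Y: "\<And>i. flow (Y i) (S i)"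
    and a: "\<And>i. 0 < \<alpha> i \<and> \<alpha> i < 1" and mix: "\<And>i. alpha_weakly_mixing_along (X i) (T i) (\<alpha> i) t"
    and \<Phi>: "flow_isomorphism (PiM I Y) (product_flow I S) (PiM I X) (product_flow I T) \<Phi>"
  shows "\<exists>\<sigma>. \<sigma> permutes I \<and> (\<forall>i\<in>I. restricts_to_isomorphism I Y S X T \<Phi> i (\<sigma> i))"
proof -
  obtain \<Psi> where \<Psi>: "\<Psi> \<in> measurable (PiM I X) (PiM I Y)" "AE y in PiM I Y. \<Psi> (\<Phi> y) = y"
    "AE x in PiM I X. \<Phi> (\<Psi> x) = x"
    using \<Phi> unfolding flow_isomorphism_def by blast
  have \<Phi>': "\<Phi> \<in> measurable (PiM I Y) (PiM I X)" "distr (PiM I Y) (PiM I X) \<Phi> = PiM I X"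
    "\<And>s. AE y in PiM I Y. product_flow I T s (\<Phi> y) = \<Phi> (product_flow I S s y)"
    using \<Phi> unfolding flow_isomorphism_def by blast+
  interpret x: flow "X i" "T i" for i by (rule X)
  interpret y: flow "Y i" "S i" for i by (rule Y)
  interpret product_isomorphism X I T t \<alpha> Y S \<Phi> \<Psi>
    by unfold_locales
      (fact I x.measurable_T x.preserving y.measurable_T y.preserving \<Psi> \<Phi>' a[THEN conjunct1] a[THEN conjunct2]
        x.alpha_weakly_mixing_events[OF mix])+
  show ?thesis
  proof (rule restricts_to_isomorphism_permutation)
    show "\<exists>U\<in>sets (X i). measure (X i) U \<noteq> 0 \<and> measure (X i) U \<noteq> 1" for i
      by (rule x.nontrivial_event[of i]) blast
    show "\<exists>U\<in>sets (Y i). measure (Y i) U \<noteq> 0 \<and> measure (Y i) U \<noteq> 1" for i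
      by (rule y.nontrivial_event[of i]) blast
    show "\<exists>\<U>. separates \<U> (X i)" for i using standard_borel_separates[OF x.standard] by blast
    show "\<exists>\<V>. separates \<V> (Y i)" for i using standard_borel_separates[OF y.standard] by blast
  qed
qed

theorem proposition7:
  fixes d :: nat
    and t :: "nat \<Rightarrow> real"
    and \<alpha> :: "nat \<Rightarrow> real"
    and X :: "nat \<Rightarrow> 'a measure"
    and T :: "nat \<Rightarrow> real \<Rightarrow> 'a \<Rightarrow> 'a"
    and Y :: "nat \<Rightarrow> 'b measure"
    and S :: "nat \<Rightarrow> real \<Rightarrow> 'b \<Rightarrow> 'b"
  assumes "d \<ge> 1"
    and "filterlim t at_top sequentially"
    and "\<And>i. i \<in> {1..d} \<Longrightarrow> flow (X i) (T i)"
    and "\<And>i. i \<in> {1..d} \<Longrightarrow> 0 < \<alpha> i \<and> \<alpha> i < 1"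
    and "\<And>i. i \<in> {1..d} \<Longrightarrow> alpha_weakly_mixing_along (X i) (T i) (\<alpha> i) t"
    and "\<And>i. i \<in> {1..d} \<Longrightarrow> flow (Y i) (S i)"
    and "\<And>i. i \<in> {1..d} \<Longrightarrow> weakly_mixing (Y i) (S i)"
  shows "(isomorphic_flows (PiM {1..d} X) (product_flow {1..d} T) (PiM {1..d} Y) (product_flow {1..d} S)
           \<longrightarrow> (\<exists>\<sigma>. \<sigma> permutes {1..d} \<and>
                 (\<forall>i\<in>{1..d}. isomorphic_flows (X i) (T i) (Y (\<sigma> i)) (S (\<sigma> i))))) \<and>
         (\<forall>\<Phi>. flow_isomorphism (PiM {1..d} Y) (product_flow {1..d} S)
               (PiM {1..d} X) (product_flow {1..d} T) \<Phi>
           \<longrightarrow> (\<exists>\<sigma>. \<sigma> permutes {1..d} \<and>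
                 (\<forall>i\<in>{1..d}. restricts_to_isomorphism {1..d} Y S X T \<Phi> i (\<sigma> i))))"
proof -
  let ?I = "{1..d}"
  \<comment> \<open>Repeat the first system outside of \<open>{1..d}\<close>, so that the hypotheses hold for every index.\<close>
  define r where "r = (\<lambda>i. if i \<in> ?I then i else 1)"
  have r: "r i \<in> ?I" for i using assms(1) by (simp add: r_def)
  have r_id: "r i = i" if "i \<in> ?I" for i using that by (simp add: r_def)
  have main: "\<exists>\<sigma>. \<sigma> permutes ?I \<and> (\<forall>i\<in>?I. restricts_to_isomorphism ?I Y S X T \<Phi> i (\<sigma> i))"
    if \<Phi>: "flow_isomorphism (PiM ?I Y) (product_flow ?I S) (PiM ?I X) (product_flow ?I T) \<Phi>" for \<Phi>
  proof -
    let ?X = "\<lambda>i. X (r i)" and ?T = "\<lambda>i. T (r i)" and ?Y = "\<lambda>i. Y (r i)" and ?S = "\<lambda>i. S (r i)"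
    have PX: "PiM ?I ?X = PiM ?I X" and PY: "PiM ?I ?Y = PiM ?I Y"
      by (auto intro!: PiM_cong simp: r_id)
    have fT: "product_flow ?I ?T = product_flow ?I T" and fS: "product_flow ?I ?S = product_flow ?I S"
      by (auto simp: product_flow_def fun_eq_iff r_id restrict_def)
    obtain \<sigma> where \<sigma>: "\<sigma> permutes ?I"
      and iso: "\<And>i. i \<in> ?I \<Longrightarrow> restricts_to_isomorphism ?I ?Y ?S ?X ?T \<Phi> i (\<sigma> i)"
      using product_flow_isomorphism_restricts[of ?I ?X ?T ?Y ?S "\<lambda>i. \<alpha> (r i)" t \<Phi>] assms(3-6)[OF r] \<Phi>
      unfolding PX PY fT fS by auto
    have "restricts_to_isomorphism ?I Y S X T \<Phi> i (\<sigma> i)" if i: "i \<in> ?I" for i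
    proof -
      have "\<sigma> i \<in> ?I" using permutes_in_image[OF \<sigma>, of i] i by blast
      then show ?thesis
        using iso[OF i] i unfolding restricts_to_isomorphism_def L2_coord_def PX PY
        by (simp only: r_id)
    qed
    with \<sigma> show ?thesis by blast
  qed
  moreover have "\<exists>\<sigma>. \<sigma> permutes ?I \<and> (\<forall>i\<in>?I. isomorphic_flows (X i) (T i) (Y (\<sigma> i)) (S (\<sigma> i)))"
    if "isomorphic_flows (PiM ?I X) (product_flow ?I T) (PiM ?I Y) (product_flow ?I S)"
    using that main unfolding isomorphic_flows_def restricts_to_isomorphism_def by meson
  ultimately show ?thesis by blast
qed

end
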